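(* Let $g \in H_2\cap W(\mathbb{R})$, and let $$(a,b)\in\left\{\left(\tfrac{1}{\sqrt2},\tfrac{1}{\sqrt2}\right),\ \left(\tfrac{1}{\sqrt3},\tfrac{1}{\sqrt3}\right),\ \left(\tfrac{2}{\sqrt3},\tfrac{1}{\sqrt3}\right),\ \left(\tfrac{1}{\sqrt3},\tfrac{2}{\sqrt3}\right)\right\}.$$ Then the Gabor system $\mathcal{G}(g,a,b)$ is not a frame for $L^2(\mathbb{R})$. In particular, for each of these four pairs $(a,b)$ and each $n=4m+2$ with $m\in\mathbb{N}\cup\{0\}$, the Gabor system $\mathcal{G}(h_n,a,b)$ is not a frame for $L^2(\mathbb{R})$.
   Context: For $g\in L^2(\mathbb{R})$ and $a,b>0$, the Gabor system is $\mathcal{G}(g,a,b)=\{e^{2\pi i b m\,\cdot}g(\cdot-ak)\}_{k,m\in\mathbb{Z}}$. It is a frame for $L^2(\mathbb{R})$ if there exist constants $A,B>0$ such that $A\|f\|^2\le\sum_{k,m\in\mathbb{Z}}|\langle f,e^{2\pi i bm\,\cdot}g(\cdot-ak)\rangle|^2\le B\|f\|^2$ for all $f\in L^2(\mathbb{R})$. The Fourier transform is $\hat f(\gamma)=\mathcal{F}f(\gamma)=\int_{\mathbb{R}}f(x)e^{-2\pi i\gamma x}\,dx$ for $f\in L^1(\mathbb{R})$, extended as usual to $L^2(\mathbb{R})$. $H_2=\ker(\mathcal{F}-(-i)^2 I)\subset L^2(\mathbb{R})$ is the eigenspace of the Fourier transform for the eigenvalue $(-i)^2=-1$. The Wiener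 space $W(\mathbb{R})$ consists of the functions $g\in L^\infty(\mathbb{R})$ with $\sum_{k\in\mathbb{Z}}\operatorname{ess\,sup}_{x\in[0,1]}|g(x+k)|<\infty$. The $n$th Hermite function is $h_n(x)=c_n^{-1/2}e^{\pi x^2}\frac{d^n}{dx^n}e^{-2\pi x^2}$ with $c_n=(2\pi)^n2^{n-1/2}n!$, $n\in\mathbb{N}\cup\{0\}$; it satisfies $\hat h_n=(-i)^nh_n$. *)

theory Defs
  imports "HOL-Analysis.Analysis" "HOL-Probability.Essential_Supremum"
begin

text \<open>
  Elements of \<open>L\<^sup>2(\<real>)\<close> are represented by Borel functions \<open>real \<Rightarrow> complex\<close>; no quotient
  is formed, since every notion below is invariant under changes on null sets. Every
  almost-everywhere class of Lebesgue measurable functions has a Borel representative.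
\<close>

definition L1 :: "(real \<Rightarrow> complex) set" where
  "L1 = {f. integrable lborel f}"

definition L2 :: "(real \<Rightarrow> complex) set" where
  "L2 = {f \<in> borel_measurable lborel. integrable lborel (\<lambda>x. (cmod (f x))\<^sup>2)}"

definition L2_inner :: "(real \<Rightarrow> complex) \<Rightarrow> (real \<Rightarrow> complex) \<Rightarrow> complex" where
  "L2_inner f g = (LINT x|lborel. f x * cnj (g x))"

definition L2_norm :: "(real \<Rightarrow> complex) \<Rightarrow> real" where
  "L2_norm f = sqrt (LINT x|lborel. (cmod (f x))\<^sup>2)"

text \<open>The explicit summability keeps the upper bound from holding via the default value
  \<open>0\<close> of a divergent \<open>infsum\<close>.\<close>

definition L2_frame :: "('i \<Rightarrow> real \<Rightarrow> complex) \<Rightarrow> bool" where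
  "L2_frame \<phi> \<longleftrightarrow> (\<exists>A B. A > 0 \<and> B > 0 \<and>
     (\<forall>f \<in> L2.
        (\<lambda>i. (cmod (L2_inner f (\<phi> i)))\<^sup>2) summable_on UNIV \<and>
        A * (L2_norm f)\<^sup>2 \<le> (\<Sum>\<^sub>\<infinity>i. (cmod (L2_inner f (\<phi> i)))\<^sup>2) \<and>
        (\<Sum>\<^sub>\<infinity>i. (cmod (L2_inner f (\<phi> i)))\<^sup>2) \<le> B * (L2_norm f)\<^sup>2))"

definition gabor_system ::
    "(real \<Rightarrow> complex) \<Rightarrow> real \<Rightarrow> real \<Rightarrow> int \<times> int \<Rightarrow> real \<Rightarrow> complex" where
  "gabor_system g a b = (\<lambda>(k, m) x.
     exp (2 * of_real pi * \<i> * of_real (b * of_int m * x)) * g (x - a * of_int k))"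

definition fourier :: "(real \<Rightarrow> complex) \<Rightarrow> real \<Rightarrow> complex" where
  "fourier f \<gamma> = (LINT x|lborel. f x * exp (- 2 * of_real pi * \<i> * of_real (\<gamma> * x)))"

text \<open>
  \<open>L2_fourier f F\<close> says that \<open>F\<close> represents the Fourier transform of \<open>f\<close> in
  \<open>L\<^sup>2(\<real>)\<close>, i.e. the continuous extension from the dense subspace \<open>L1 \<inter> L2\<close>. By
  Plancherel, \<open>F\<close> is unique up to null sets and does not depend on the sequence, and
  \<open>fourier (s n) \<in> L2\<close> is automatic; it is stated because \<open>L2_norm\<close> is
  meaningful only on \<open>L2\<close>.
\<close>

definition L2_fourier :: "(real \<Rightarrow> complex) \<Rightarrow> (real \<Rightarrow> complex) \<Rightarrow> bool" where
  "L2_fourier f F \<longleftrightarrow> f \<in> L2 \<and> F \<in> L2 \<and>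
     (\<exists>s :: nat \<Rightarrow> real \<Rightarrow> complex.
        (\<forall>n. s n \<in> L1 \<inter> L2 \<and> fourier (s n) \<in> L2) \<and>
        (\<lambda>n. L2_norm (\<lambda>x. s n x - f x)) \<longlonglongrightarrow> 0 \<and>
        (\<lambda>n. L2_norm (\<lambda>\<gamma>. fourier (s n) \<gamma> - F \<gamma>)) \<longlonglongrightarrow> 0)"

definition fourier_eigenspace :: "nat \<Rightarrow> (real \<Rightarrow> complex) set" where
  "fourier_eigenspace n = {f \<in> L2. L2_fourier f (\<lambda>x. (- \<i>) ^ n * f x)}"

definition wiener_space :: "(real \<Rightarrow> complex) set" where
  "wiener_space = {g \<in> borel_measurable lborel.
     esssup lborel (\<lambda>x. ennreal (cmod (g x))) < \<infinity> \<and>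
     (\<Sum>\<^sub>\<infinity>k::int. esssup (restrict_space lborel {0..1})
        (\<lambda>x. ennreal (cmod (g (x + of_int k))))) < \<infinity>}"

definition hermite_const :: "nat \<Rightarrow> real" where
  "hermite_const n = (2 * pi) ^ n * 2 powr (real n - 1 / 2) * fact n"

definition hermite_fun :: "nat \<Rightarrow> real \<Rightarrow> real" where
  "hermite_fun n x = hermite_const n powr (- 1 / 2) * exp (pi * x\<^sup>2) *
     (deriv ^^ n) (\<lambda>t. exp (- 2 * pi * t\<^sup>2)) x"

end

theory Submission
  imports Defs "HOL-Probability.Characteristic_Functions" "HOL-Real_Asymp.Real_Asymp"
begin

text \<open>
  Put \<open>N = 2\<close> or \<open>N = 3\<close>. The systems with parameters \<open>(2/\<surd>3, 1/\<surd>3)\<close> and \<open>(1/\<surd>3, 2/\<surd>3)\<close> are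
  subfamilies of the one with parameters \<open>(1/\<surd>3, 1/\<surd>3)\<close>, and a failure of the lower frame bound
  passes to subfamilies. So it suffices to defeat the lower bound for the square lattice of
  side \<open>1/\<surd>N\<close>, a lattice that the Fourier transform maps to itself.

  For a continuous \<open>g\<close> with a summable majorant and \<open>fourier g = - g\<close>, consider the \<open>N\<close> alternating
  sums \<open>P\<^sub>r = \<Sum>\<^sub>j (-1)\<^sup>j g (\<surd>N (j + (r + 1/2)/N))\<close>. Poisson summation turns such a sum into a sum of
  samples of \<open>fourier g\<close> on the shifted dual lattice \<open>(\<int> + 1/2)/\<surd>N\<close>, which splits into the same \<open>N\<close>
  sums again. Thus \<open>P = - M P\<close>, where \<open>M\<close> is the matrix with the entries
  \<open>N\<^sup>-\<^sup>1\<^sup>/\<^sup>2 exp (2 \<pi> \<i> (r + 1/2) (s + 1/2) / N)\<close>. The eigenvalues of \<open>M\<close> are \<open>1, \<i>\<close> for \<open>N = 2\<close> and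
  \<open>1, \<i>, -\<i>\<close> for \<open>N = 3\<close>. As \<open>-1\<close> is not among them, all the sums vanish
  (\<open>alternating_sums_vanish\<close>).

  Formally this says that the comb \<open>\<Sum>\<^sub>j (-1)\<^sup>j \<delta>\<close> at the points \<open>\<surd>N (j + 1/(2N))\<close> is orthogonal to the
  whole Gabor system. An honest test function arises by keeping the \<open>2R + 1\<close> central teeth and by
  widening each of them to a short interval of length \<open>\<epsilon>\<close> (\<open>gabor_test_functions\<close>). Bessel's
  inequality for Fourier series, applied in the modulation index, bounds the frame sum by
  integrals of squared truncated sums near one point, and the length of the interval cancels
  against the norm of the test function. What remains is to convolve an absolutely summable
  sequence of sum zero with a box of length \<open>2R + 1\<close>: the square sum of the result is \<open>o(R)\<close>
  (\<open>box_sums_of_null_series_small\<close>), whereas the squared norm of the test function grows like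
  \<open>2R + 1\<close>. Hence no positive lower frame bound exists.

  A member \<open>g\<close> of the eigenspace that lies in the Wiener space is integrable, so that \<open>- fourier g\<close>
  is a continuous representative of it, with the same majorant (\<open>continuous_representative\<close>).
  Hermite functions are continuous and decay fast, and integration by parts shows that they are
  eigenfunctions for \<open>(-\<i>)\<^sup>n\<close> (\<open>hermite_fun_eigenfunction\<close>); this is \<open>-1\<close> for \<open>n = 4m + 2\<close>.
\<close>

section \<open>Uniqueness of Fourier coefficients\<close>

text \<open>
  Integrate against the powers of \<open>Q t = cos\<^sup>2 (\<pi> (t - x))\<close>. These are trigonometric polynomials, so
  all the integrals vanish, but they peak at \<open>x\<close>: if \<open>D x \<noteq> 0\<close>, then a neighbourhood of \<open>x\<close>
  contributes at least a constant times \<open>q1\<^sup>n\<close> to the real part of \<open>cnj (D x) D\<close> against \<open>Q\<^sup>n\<close>, while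
  the points away from \<open>x\<close> contribute at most a constant times \<open>q2\<^sup>n\<close> with \<open>q2 < q1\<close>.
\<close>

lemma fourier_coefficients_determine_continuous:
  fixes D :: "real \<Rightarrow> complex"
  assumes cont: "continuous_on {0..1} D"
    and coeff: "\<And>k::int. integral {0..1} (\<lambda>t. D t * cis (2 * pi * of_int k * t)) = 0"
    and x: "0 < x" "x < 1"
  shows "D x = 0"
proof (rule ccontr)
  assume nz: "D x \<noteq> 0"
  define Q where "Q t = (cos (pi * (t - x)))\<^sup>2" for t
  have contQ [continuous_intros]: "continuous_on A Q" for A
    unfolding Q_def by (intro continuous_intros)
  have kernel: "integral {0..1} (\<lambda>t. D t * cis (2 * pi * of_int k * t) * of_real (Q t ^ n)) = 0" for n and k :: int
  proof (induction n arbitrary: k)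
    case 0
    then show ?case using coeff by simp
  next
    case (Suc n)
    let ?F = "\<lambda>k t. D t * cis (2 * pi * of_int k * t) * of_real (Q t ^ n)"
    have int: "?F j integrable_on {0..1}" for j :: int
      by (intro integrable_continuous_interval continuous_intros cont)
    have Q: "of_real (Q t) = 1/2 + cis (- 2 * pi * x) / 4 * cis (2 * pi * t) + cis (2 * pi * x) / 4 * cis (- (2 * pi * t))" for t
    proof -
      have "cis (2 * pi * x) * cis (- (2 * pi * t)) = cis (- (2 * pi * (t - x)))"
           "cis (- 2 * pi * x) * cis (2 * pi * t) = cis (2 * pi * (t - x))"
        by (simp_all add: cis_mult algebra_simps)
      moreover have "Q t = 1/2 + cos (2 * (pi * (t - x))) / 2"
        unfolding Q_def cos_double_cos by (simp add: field_simps)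
      ultimately show ?thesis by (simp add: complex_eq_iff algebra_simps)
    qed
    have eq: "D t * cis (2 * pi * of_int k * t) * of_real (Q t ^ Suc n) =
        1/2 * ?F k t + cis (- 2 * pi * x) / 4 * ?F (k + 1) t + cis (2 * pi * x) / 4 * ?F (k - 1) t" for t
    proof -
      have "cis (2 * pi * of_int (k + 1) * t) = cis (2 * pi * of_int k * t) * cis (2 * pi * t)"
           "cis (2 * pi * of_int (k - 1) * t) = cis (2 * pi * of_int k * t) * cis (- (2 * pi * t))"
        by (simp_all add: cis_mult algebra_simps)
      then show ?thesis
        unfolding power_Suc of_real_mult Q by (simp add: algebra_simps)
    qed
    show ?case unfolding eq
      by (subst integral_add integral_mult_right; (intro integrable_add integrable_on_mult_right int)?)+ (simp only: Suc.IH mult_zero_right add_0)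
  qed
  define c where "c = D x"
  define E where "E t = Re (cnj c * D t)" for t
  have contE: "continuous_on {0..1} E"
    unfolding E_def by (intro continuous_intros cont)
  have Ex: "E x > 0"
    using nz unfolding E_def c_def by (auto simp: complex_eq_iff sum_squares_gt_zero_iff)
  have kernelE: "integral {0..1} (\<lambda>t. E t * Q t ^ n) = 0" for n
  proof -
    have "((\<lambda>t. D t * of_real (Q t ^ n)) has_integral 0) {0..1}"
    proof (rule has_integral_integrable_integral[THEN iffD2], intro conjI)
      show "(\<lambda>t. D t * of_real (Q t ^ n)) integrable_on {0..1}"
        by (intro integrable_continuous_interval continuous_intros cont)
    qed (use kernel[of 0 n] in simp)
    from has_integral_linear[OF has_integral_mult_right[OF this, of "cnj c"] bounded_linear_Re]
    have "((\<lambda>t. E t * Q t ^ n) has_integral 0) {0..1}"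
      by (simp add: o_def E_def algebra_simps)
    then show ?thesis by (rule integral_unique)
  qed
  obtain M where M': "\<forall>t\<in>{0..1}. \<bar>E t\<bar> \<le> M" "M > 0"
    using compact_imp_bounded[OF compact_continuous_image[OF contE]] unfolding bounded_pos by auto
  have M: "\<bar>E t\<bar> \<le> M" "M > 0" if "t \<in> {0..1}" for t
    using M' that by auto
  obtain d where d: "d > 0" "\<And>t. t \<in> {0..1} \<Longrightarrow> \<bar>t - x\<bar> \<le> d \<Longrightarrow> E t \<ge> E x / 2"
  proof -
    obtain d where d: "d > 0" "\<And>t. t \<in> {0..1} \<Longrightarrow> dist t x \<le> d \<Longrightarrow> dist (E t) (E x) < E x / 2"
      by (rule continuous_onE[OF contE, of x "E x / 2"]) (use x Ex in simp_all)
    have "E t \<ge> E x / 2" if t: "t \<in> {0..1}" "\<bar>t - x\<bar> \<le> d" for t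
    proof -
      have "\<bar>E t - E x\<bar> < E x / 2"
        using d(2)[OF t(1)] t(2) by (simp add: dist_real_def)
      then show ?thesis by linarith
    qed
    then show ?thesis by (rule that[OF d(1)])
  qed
  \<comment> \<open>As \<open>\<delta> \<le> min x (1 - x)\<close>, points of the unit interval have distance at most \<open>1 - \<delta>\<close> from
    \<open>x\<close>, which is away from the next peaks of the kernel.\<close>
  define \<delta> where "\<delta> = min d (min x (1 - x) / 2)"
  have \<delta>: "\<delta> > 0" "\<delta> \<le> d" "\<delta> \<le> x" "\<delta> \<le> 1 - x" "\<delta> \<le> 1/2" "\<delta> < 1/2"
    using d x by (auto simp: \<delta>_def min_def)
  define q1 where "q1 = (cos (pi * (\<delta> / 2)))\<^sup>2"
  define q2 where "q2 = (cos (pi * \<delta>))\<^sup>2"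
  have cpos: "cos (pi * \<delta>) > 0" 
    using \<delta> pi_gt_zero by (intro cos_gt_zero) (simp_all add: field_simps)
  have "cos (pi * \<delta>) < cos (pi * (\<delta>/2))"
    using \<delta> pi_gt_zero by (intro cos_monotone_0_pi) auto
  then have q: "0 \<le> q2" "q2 < q1" "q1 > 0"
    using cpos unfolding q1_def q2_def by (auto intro!: power_strict_mono)
  have cos_abs: "cos (pi * \<bar>s\<bar>) = cos (pi * s)" for s :: real
    by (cases "s \<ge> 0") simp_all
  have Qin: "Q t \<ge> q1" if "\<bar>t - x\<bar> \<le> \<delta> / 2" for t
  proof -
    have "cos (pi * (\<delta>/2)) \<le> cos (pi * \<bar>t - x\<bar>)"
      using that \<delta> by (intro cos_monotone_0_pi_le) auto
    moreover have "cos (pi * (\<delta>/2)) > 0"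
      using cpos \<open>cos (pi * \<delta>) < cos (pi * (\<delta>/2))\<close> by linarith
    moreover have "cos (pi * \<bar>t - x\<bar>) = cos (pi * (t - x))"
      by (rule cos_abs)
    ultimately show ?thesis unfolding Q_def q1_def by (intro power_mono) auto
  qed
  have Qout: "Q t \<le> q2" if "\<bar>t - x\<bar> \<ge> \<delta>" "t \<in> {0..1}" for t
  proof -
    have t: "\<bar>t - x\<bar> \<le> 1 - \<delta>"
      using that \<delta> by auto
    have le: "pi * \<bar>t - x\<bar> \<le> pi * (1 - \<delta>)" "pi * \<bar>t - x\<bar> \<le> pi * 1"
      using t \<delta> by (intro mult_left_mono; simp)+
    have "cos (pi * \<bar>t - x\<bar>) \<le> cos (pi * \<delta>)"
      using that \<delta> le by (intro cos_monotone_0_pi_le) auto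
    moreover have "cos (pi - pi * \<delta>) \<le> cos (pi * \<bar>t - x\<bar>)"
      using \<delta> le by (intro cos_monotone_0_pi_le) (auto simp: algebra_simps)
    ultimately have "\<bar>cos (pi * \<bar>t - x\<bar>)\<bar> \<le> cos (pi * \<delta>)"
      by (simp add: cos_diff)
    moreover have "cos (pi * \<bar>t - x\<bar>) = cos (pi * (t - x))"
      by (rule cos_abs)
    ultimately show ?thesis unfolding Q_def q2_def
      by (simp add: abs_le_square_iff[symmetric])
  qed
  have main: "\<delta> * (E x / 2) * q1 ^ n \<le> M * q2 ^ n" for n
  proof -
    let ?h = "\<lambda>t. E t * Q t ^ n + M * q2 ^ n"
    have conth: "continuous_on {0..1} ?h" by (intro continuous_intros contE)
    have sub: "{x - \<delta>/2..x + \<delta>/2} \<subseteq> {0..1}" using \<delta> by auto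
    have "integral {x - \<delta>/2..x + \<delta>/2} (\<lambda>t. E x / 2 * q1 ^ n) \<le> integral {x - \<delta>/2..x + \<delta>/2} ?h"
    proof (rule integral_le)
      show "?h integrable_on {x - \<delta>/2..x + \<delta>/2}"
        using continuous_on_subset[OF conth sub] by (rule integrable_continuous_interval)
      fix t assume t: "t \<in> {x - \<delta>/2..x + \<delta>/2}"
      then have t': "\<bar>t - x\<bar> \<le> \<delta> / 2" 
        unfolding atLeastAtMost_iff by linarith
      have "E x / 2 * q1 ^ n \<le> E t * Q t ^ n"
      proof (intro mult_mono power_mono Qin t')
        show "E x / 2 \<le> E t" using t' sub t \<delta> by (intro d(2)) auto
        then show "0 \<le> E t" using Ex by linarith
      qed (use q in auto)
      then show "E x / 2 * q1 ^ n \<le> ?h t" using M'(2) q by (simp add: add_increasing2)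
    qed auto
    also have "\<dots> \<le> integral {0..1} ?h"
    proof (rule integral_subset_le[OF sub])
      show "\<forall>t\<in>{0..1}. 0 \<le> ?h t"
      proof
        fix t :: real assume t: "t \<in> {0..1}"
        show "0 \<le> ?h t"
        proof (cases "\<bar>t - x\<bar> \<le> \<delta>")
          case True
          then have "E t \<ge> 0" using d(2)[OF t] \<delta> Ex by linarith
          then show ?thesis using M'(2) q by (auto simp: Q_def intro!: add_nonneg_nonneg mult_nonneg_nonneg)
        next
          case False
          have "\<bar>E t * Q t ^ n\<bar> \<le> M * q2 ^ n"
            unfolding abs_mult power_abs using M(1)[OF t] Qout[of t] False t M'(2)
            by (intro mult_mono power_mono) (auto simp: Q_def)
          then show ?thesis by linarith
        qed
      qed
    qed (use conth sub in \<open>auto intro!: integrable_continuous_interval intro: continuous_on_subset\<close>)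
    also have "\<dots> = M * q2 ^ n"
      by (subst integral_add) (auto intro!: integrable_continuous_interval continuous_intros contE simp: kernelE)
    finally show ?thesis using \<delta> by (simp add: algebra_simps)
  qed
  have "(\<lambda>n. M * (q2 / q1) ^ n) \<longlonglongrightarrow> M * 0"
    using q by (intro tendsto_intros LIMSEQ_realpow_zero) (auto simp: field_simps)
  moreover have "\<delta> * (E x / 2) > 0" using \<delta> Ex by auto
  ultimately have "eventually (\<lambda>n. M * (q2 / q1) ^ n < \<delta> * (E x / 2)) sequentially"
    by (intro order_tendstoD) auto
  then obtain n where "M * (q2 / q1) ^ n < \<delta> * (E x / 2)"
    by (auto simp: eventually_sequentially)
  then show False using main[of n] q by (simp add: field_simps power_divide)
qed

section \<open>Integrals over unit tiles and Poisson summation\<close>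

text \<open>
  A pointwise form of the Wiener space. The majorant is kept explicit because it is handed to
  the Weierstrass test; closed tiles make the condition directly usable on \<open>{0..1}\<close>.
\<close>

definition tile_dominated :: "(real \<Rightarrow> complex) \<Rightarrow> (int \<Rightarrow> real) \<Rightarrow> bool" where
  "tile_dominated G v \<longleftrightarrow> v summable_on UNIV \<and>
     (\<forall>k. \<forall>t\<in>{0..1}. cmod (G (t + of_int k)) \<le> v k)"

lemma tile_dominatedD:
  assumes "tile_dominated G v"
  shows "v summable_on UNIV" "t \<in> {0..1} \<Longrightarrow> cmod (G (t + of_int k)) \<le> v k"
    "0 \<le> v k" "cmod (G x) \<le> v \<lfloor>x\<rfloor>"
proof -
  show "v summable_on UNIV" and le: "t \<in> {0..1} \<Longrightarrow> cmod (G (t + of_int k)) \<le> v k" for t k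
    using assms by (auto simp: tile_dominated_def)
  show "0 \<le> v k" using order_trans[OF norm_ge_zero le[of 0 k]] by simp
  show "cmod (G x) \<le> v \<lfloor>x\<rfloor>"
    using le[of "frac x" "\<lfloor>x\<rfloor>"] by (simp add: frac_def floor_correct) linarith
qed

lemma has_sum_finite_sum:
  fixes f :: "'i \<Rightarrow> 'a \<Rightarrow> 'b :: {comm_monoid_add, topological_comm_monoid_add}"
  assumes "\<And>i. i \<in> I \<Longrightarrow> (f i has_sum S i) A"
  shows "((\<lambda>x. \<Sum>i\<in>I. f i x) has_sum (\<Sum>i\<in>I. S i)) A"
  using assms by (induction I rule: infinite_finite_induct) (auto intro: has_sum_add)

lemma has_sum_diff:
  fixes f g :: "'a \<Rightarrow> 'b :: real_normed_vector"
  assumes "(f has_sum a) A" "(g has_sum b) A"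
  shows "((\<lambda>x. f x - g x) has_sum a - b) A"
  using has_sum_add[OF assms(1), of "\<lambda>x. - g x" "- b"] assms(2) by (simp add: has_sum_uminus)

definition tile :: "int \<Rightarrow> real set" where
  "tile k = {of_int k..<of_int k + 1}"

lemma tile_measurable [measurable]: "tile k \<in> sets borel"
  by (simp add: tile_def)

lemma mem_tile_iff: "x \<in> tile k \<longleftrightarrow> \<lfloor>x\<rfloor> = k"
  by (auto simp: tile_def floor_eq_iff)

lemma UN_tile_decode: "(\<Union>n. tile (int_decode n)) = UNIV"
  using surj_int_decode by (auto simp: mem_tile_iff) (metis surjE)

lemma disjoint_tile_decode: "disjoint_family (\<lambda>n. tile (int_decode n))"
  using injD[OF inj_int_decode] by (auto simp: disjoint_family_on_def mem_tile_iff)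

text \<open>
  Countable additivity along an enumeration of the tiles; applied to the norm of \<open>f\<close> as well it
  gives absolute convergence, which makes the order of summation irrelevant.
\<close>

lemma has_sum_set_integral_tile:
  fixes f :: "real \<Rightarrow> complex"
  assumes f: "integrable lborel f"
  shows "((\<lambda>k. LINT x:tile k|lborel. f x) has_sum (LINT x|lborel. f x)) UNIV"
proof -
  have sums: "(\<lambda>n. LINT x:tile (int_decode n)|lborel. h x) sums (LINT x|lborel. h x)"
    if h: "integrable lborel h" for h :: "real \<Rightarrow> 'b :: {banach, second_countable_topology}"
  proof -
    have si: "set_integrable lborel A h" if "A \<in> sets borel" for A
      using that h by (auto simp: set_integrable_def intro: integrable_mult_indicator)
    have "(\<lambda>n. LINT x:(\<Union>i<n. tile (int_decode i))|lborel. h x) \<longlonglongrightarrow> (LINT x:(\<Union>n. \<Union>i<n. tile (int_decode i))|lborel. h x)"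
      by (rule set_integral_cont_up) (auto 0 3 simp: incseq_def intro!: si intro: less_le_trans)
    also have "(\<Union>n. \<Union>i<n. tile (int_decode i)) = UNIV"
      using UN_tile_decode UN_UN_finite_eq[of "\<lambda>n. tile (int_decode n)"] by (simp add: lessThan_atLeast0)
    also have "(LINT x:UNIV|lborel. h x) = (LINT x|lborel. h x)"
      by (simp add: set_lebesgue_integral_def)
    also have "(\<lambda>n. LINT x:(\<Union>i<n. tile (int_decode i))|lborel. h x) = 
        (\<lambda>n. \<Sum>i<n. LINT x:tile (int_decode i)|lborel. h x)"
      by (rule ext, rule set_integral_finite_Union)
        (auto intro!: si disjoint_family_on_mono[OF _ disjoint_tile_decode])
    finally show ?thesis by (simp add: sums_def)
  qed
  have "summable (\<lambda>n. norm (LINT x:tile (int_decode n)|lborel. f x))"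
  proof (rule summable_comparison_test')
    show "summable (\<lambda>n. LINT x:tile (int_decode n)|lborel. norm (f x))"
      using sums[OF integrable_norm[OF f]] by (rule sums_summable)
    show "norm (norm (LINT x:tile (int_decode n)|lborel. f x)) \<le> (LINT x:tile (int_decode n)|lborel. norm (f x))" for n
      unfolding set_lebesgue_integral_def
      by (simp, rule order_trans[OF integral_norm_bound]) (simp add: abs_mult)
  qed
  then have "((\<lambda>n. LINT x:tile (int_decode n)|lborel. f x) has_sum (LINT x|lborel. f x)) UNIV"
    using sums[OF f] by (rule norm_summable_imp_has_sum)
  then show ?thesis
    using has_sum_reindex_bij_betw[OF bij_int_decode, of "\<lambda>k. LINT x:tile k|lborel. f x"] by simp
qed

lemma integrable_floor_sequence:
  fixes v :: "int \<Rightarrow> real"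
  assumes v: "v summable_on UNIV" and nonneg: "\<And>k. 0 \<le> v k"
  shows "integrable lborel (\<lambda>x::real. v \<lfloor>x\<rfloor>)"
proof (rule integrableI_bounded)
  show meas [measurable]: "(\<lambda>x::real. v \<lfloor>x\<rfloor>) \<in> borel_measurable lborel"
    by measurable
  have "(\<integral>\<^sup>+x. ennreal (norm (v \<lfloor>x::real\<rfloor>)) \<partial>lborel) = (\<Sum>n. \<integral>\<^sup>+x\<in>tile (int_decode n). ennreal (norm (v \<lfloor>x\<rfloor>)) \<partial>lborel)"
    by (subst nn_integral_disjoint_family[symmetric]) (simp_all add: UN_tile_decode disjoint_tile_decode)
  also have "\<dots> = (\<Sum>n. ennreal (v (int_decode n)))"
  proof (rule suminf_cong)
    fix n
    have "(\<integral>\<^sup>+x\<in>tile (int_decode n). ennreal (norm (v \<lfloor>x\<rfloor>)) \<partial>lborel) = (\<integral>\<^sup>+x\<in>tile (int_decode n). ennreal (v (int_decode n)) \<partial>lborel)"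
      by (rule nn_integral_cong) (auto simp: mem_tile_iff nonneg indicator_def)
    then show "(\<integral>\<^sup>+x\<in>tile (int_decode n). ennreal (norm (v \<lfloor>x\<rfloor>)) \<partial>lborel) = ennreal (v (int_decode n))"
      by (simp add: nn_integral_cmult_indicator tile_def)
  qed
  also have "\<dots> < \<infinity>"
  proof -
    have "(\<lambda>n. v (int_decode n)) summable_on UNIV"
      using v summable_on_reindex_bij_betw[OF bij_int_decode, of v] by simp
    then have "summable (\<lambda>n. v (int_decode n))"
      by (rule summable_on_imp_summable)
    then show ?thesis
      using nonneg by (simp add: suminf_ennreal_eq[OF _ summable_sums] less_top)
  qed
  finally show "(\<integral>\<^sup>+x. ennreal (norm (v \<lfloor>x::real\<rfloor>)) \<partial>lborel) < \<infinity>" .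
qed

lemma tile_dominated_integrable:
  assumes "G \<in> borel_measurable borel" "tile_dominated G v"
  shows "integrable lborel G"
  using integrable_floor_sequence[OF tile_dominatedD(1,3)[OF assms(2)]]
  by (rule Bochner_Integration.integrable_bound) (use assms tile_dominatedD(3,4)[OF assms(2)] in \<open>auto simp: abs_of_nonneg\<close>)

text \<open>
  The Weierstrass test gives uniform convergence on \<open>{0..1}\<close>, which allows termwise integration.
\<close>

lemma has_sum_integral_dominated:
  fixes F :: "int \<Rightarrow> real \<Rightarrow> complex"
  assumes cont: "\<And>k. continuous_on {0..1} (F k)"
    and le: "\<And>k t. t \<in> {0..1} \<Longrightarrow> cmod (F k t) \<le> v k" and v: "v summable_on UNIV"
  shows "((\<lambda>k. integral {0..1} (F k)) has_sum integral {0..1} (\<lambda>t. \<Sum>\<^sub>\<infinity>k. F k t)) UNIV"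
    and "continuous_on {0..1} (\<lambda>t. \<Sum>\<^sub>\<infinity>k. F k t)"
proof -
  have lim: "uniform_limit {0..1} (\<lambda>X t. \<Sum>k\<in>X. F k t) (\<lambda>t. \<Sum>\<^sub>\<infinity>k. F k t) (finite_subsets_at_top UNIV)"
    by (rule Weierstrass_m_test_general[OF le v]) auto
  have contX: "continuous_on {0..1} (\<lambda>t. \<Sum>k\<in>X. F k t)" for X
    by (intro continuous_intros cont)
  show "continuous_on {0..1} (\<lambda>t. \<Sum>\<^sub>\<infinity>k. F k t)"
    by (rule uniform_limit_theorem[OF _ lim]) (auto intro!: always_eventually contX)
  obtain I J where IJ: "\<And>X. ((\<lambda>t. \<Sum>k\<in>X. F k t) has_integral I X) {0..1}"
      "((\<lambda>t. \<Sum>\<^sub>\<infinity>k. F k t) has_integral J) {0..1}" "(I \<longlongrightarrow> J) (finite_subsets_at_top UNIV)"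
    using uniform_limit_integral[OF lim contX] by (metis finite_subsets_at_top_neq_bot)
  have "eventually (\<lambda>X. I X = (\<Sum>k\<in>X. integral {0..1} (F k))) (finite_subsets_at_top UNIV)"
  proof (rule eventually_mono[OF eventually_finite_subsets_at_top_weakI])
    fix X :: "int set" assume "finite X"
    then have "((\<lambda>t. \<Sum>k\<in>X. F k t) has_integral (\<Sum>k\<in>X. integral {0..1} (F k))) {0..1}"
      by (intro has_integral_sum integrable_integral integrable_continuous_interval cont)
    then show "I X = (\<Sum>k\<in>X. integral {0..1} (F k))"
      using IJ(1) has_integral_unique by blast
  qed auto
  from Lim_transform_eventually[OF IJ(3) this] integral_unique[OF IJ(2)]
  show "((\<lambda>k. integral {0..1} (F k)) has_sum integral {0..1} (\<lambda>t. \<Sum>\<^sub>\<infinity>k. F k t)) UNIV"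
    by (simp add: has_sum_def)
qed

lemma set_integral_tile_eq_integral:
  fixes f :: "real \<Rightarrow> complex"
  assumes "continuous_on UNIV f"
  shows "(LINT x:tile k|lborel. f x) = integral {0..1} (\<lambda>t. f (t + of_int k))"
proof -
  have "(LINT x:tile k|lborel. f x) = (LINT x|lborel. indicator (tile k) (of_int k + 1 * x) *\<^sub>R f (of_int k + 1 * x))"
    unfolding set_lebesgue_integral_def by (subst lborel_integral_real_affine[of 1 _ "of_int k"]) simp_all
  also have "\<dots> = (LINT t:{0..<1}|lborel. f (t + of_int k))"
    unfolding set_lebesgue_integral_def 
    by (intro Bochner_Integration.integral_cong) (auto simp: tile_def indicator_def add.commute)
  also have "\<dots> = (LINT t:{0..1}|lborel. f (t + of_int k))"
  proof -
    have [measurable]: "(\<lambda>t. f (t + of_int k)) \<in> borel_measurable borel"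
      by (intro borel_measurable_continuous_onI continuous_on_compose2[OF assms] continuous_intros) auto
    show ?thesis
      unfolding set_lebesgue_integral_def using AE_lborel_singleton[of "1::real"]
      by (intro integral_cong_AE) (measurable, auto simp: indicator_def elim!: eventually_mono)
  qed
  also have "\<dots> = integral {0..1} (\<lambda>t. f (t + of_int k))"
    by (intro set_borel_integral_eq_integral borel_integrable_atLeastAtMost' continuous_on_compose2[OF assms] continuous_intros) auto
  finally show ?thesis .
qed

lemma cis_add_int_period: "cis (2 * pi * of_int k * (t + of_int j)) = cis (2 * pi * of_int k * t)"
proof -
  have "cis (2 * pi * of_int k * (t + of_int j)) = cis (2 * pi * of_int k * t) * cis (2 * pi * of_int (k * j))"
    by (simp add: cis_mult algebra_simps)
  then show ?thesis using cis_multiple_2pi[of "of_int (k * j)"] by (simp add: mult_ac)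
qed

lemma integral_cis_int:
  fixes k :: int
  shows "integral {a..a + 1} (\<lambda>t. cis (2 * pi * of_int k * t)) = (if k = 0 then 1 else 0)"
proof (cases "k = 0")
  case False
  define c where "c = 2 * pi * of_int k * \<i>"
  have c: "c \<noteq> 0" using False by (simp add: c_def)
  have "((\<lambda>t. cis (2 * pi * of_int k * t)) has_integral
      cis (2 * pi * of_int k * (a + 1)) / c - cis (2 * pi * of_int k * a) / c) {a..a + 1}"
  proof (rule fundamental_theorem_of_calculus)
    fix t :: real
    have "((\<lambda>t. exp (c * of_real t) / c) has_vector_derivative exp (c * of_real t)) (at t within {a..a + 1})"
      using c by (auto intro!: derivative_eq_intros has_vector_derivative_real_field simp: scaleR_conv_of_real)
    then show "((\<lambda>t. cis (2 * pi * of_int k * t) / c) has_vector_derivative cis (2 * pi * of_int k * t)) (at t within {a..a + 1})"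
      by (simp add: cis_conv_exp c_def mult_ac)
  qed simp
  then show ?thesis using False cis_add_int_period[of k a 1] by (simp add: integral_unique)
qed simp

lemma fourier_eq_cis: "fourier f \<gamma> = (LINT x|lborel. f x * cis (- (2 * pi * \<gamma> * x)))"
  unfolding fourier_def cis_conv_exp by (intro Bochner_Integration.integral_cong) (simp_all add: mult_ac)

text \<open>
  Both sides are continuous functions of \<open>t\<close> with the same Fourier coefficients: on the left,
  integrating the translates of \<open>G\<close> over one period unfolds to an integral over the real line.
\<close>

lemma poisson_summation:
  assumes cont: "continuous_on UNIV G" and dom: "tile_dominated G v"
    and hat: "(\<lambda>k::int. cmod (fourier G (of_int k))) summable_on UNIV"
    and t: "0 < t" "t < 1"
  shows "(\<Sum>\<^sub>\<infinity>j. G (t + of_int j)) = (\<Sum>\<^sub>\<infinity>k::int. fourier G (of_int k) * cis (2 * pi * of_int k * t))"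
proof -
  note dom' = tile_dominatedD[OF dom]
  let ?S = "\<lambda>t. \<Sum>\<^sub>\<infinity>j. G (t + of_int j)"
  let ?T = "\<lambda>t. \<Sum>\<^sub>\<infinity>k::int. fourier G (of_int k) * cis (2 * pi * of_int k * t)"
  have contG: "continuous_on A (\<lambda>t. G (t + c))" for c A
    by (intro continuous_on_compose2[OF cont] continuous_intros) auto
  have S: "integral {0..1} (\<lambda>t. ?S t * cis (2 * pi * of_int m * t)) = fourier G (- of_int m)" for m :: int
  proof -
    let ?F = "\<lambda>k t. G (t + of_int k) * cis (2 * pi * of_int m * t)"
    have "((\<lambda>k. integral {0..1} (?F k)) has_sum integral {0..1} (\<lambda>t. \<Sum>\<^sub>\<infinity>k. ?F k t)) UNIV"
      by (rule has_sum_integral_dominated(1)[OF _ _ dom'(1)])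
        (auto simp: norm_mult dom'(2) intro!: continuous_intros contG)
    moreover have "((\<lambda>k. integral {0..1} (?F k)) has_sum fourier G (- of_int m)) UNIV"
    proof -
      have c: "continuous_on UNIV (\<lambda>x. G x * cis (2 * pi * of_int m * x))"
        by (intro continuous_intros cont)
      have "integrable lborel (\<lambda>x. G x * cis (2 * pi * of_int m * x))"
        by (rule tile_dominated_integrable[where v = v])
          (use dom in \<open>auto simp: tile_dominated_def norm_mult intro!: borel_measurable_continuous_onI c\<close>)
      from has_sum_set_integral_tile[OF this] show ?thesis
      proof (subst (asm) set_integral_tile_eq_integral[OF c])
        show "((\<lambda>k. integral {0..1} (\<lambda>t. G (t + of_int k) * cis (2 * pi * of_int m * (t + of_int k)))) has_sum
          (LINT x|lborel. G x * cis (2 * pi * of_int m * x))) UNIV \<Longrightarrow> ?thesis"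
          by (simp add: fourier_eq_cis cis_add_int_period)
      qed
    qed
    ultimately have "integral {0..1} (\<lambda>t. \<Sum>\<^sub>\<infinity>k. ?F k t) = fourier G (- of_int m)"
      by (rule has_sum_unique)
    then show ?thesis by (subst (asm) infsum_cmult_left') 
  qed
  have T: "integral {0..1} (\<lambda>t. ?T t * cis (2 * pi * of_int m * t)) = fourier G (- of_int m)" for m :: int
  proof -
    let ?F = "\<lambda>k::int. \<lambda>t. fourier G (of_int k) * cis (2 * pi * of_int k * t) * cis (2 * pi * of_int m * t)"
    have "((\<lambda>k. integral {0..1} (?F k)) has_sum integral {0..1} (\<lambda>t. \<Sum>\<^sub>\<infinity>k. ?F k t)) UNIV"
      by (rule has_sum_integral_dominated(1)[OF _ _ hat])
        (auto simp: norm_mult intro!: continuous_intros)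
    moreover have "integral {0..1} (?F k) = (if k = -m then fourier G (- of_int m) else 0)" for k
    proof -
      have "?F k = (\<lambda>t. fourier G (of_int k) * cis (2 * pi * of_int (k + m) * t))"
        by (rule ext) (simp add: cis_mult algebra_simps)
      then have "integral {0..1} (?F k) = fourier G (of_int k) * integral {0..1} (\<lambda>t. cis (2 * pi * of_int (k + m) * t))"
        by (simp only: integral_mult_right)
      then show ?thesis using integral_cis_int[of 0 "k + m"] by auto
    qed
    moreover have "((\<lambda>k. if k = -m then fourier G (- of_int m) else 0) has_sum fourier G (- of_int m)) UNIV"
      by (rule has_sum_finite_neutralI[of "{-m}"]) auto
    ultimately have "integral {0..1} (\<lambda>t. \<Sum>\<^sub>\<infinity>k. ?F k t) = fourier G (- of_int m)"
      by (simp only: has_sum_unique)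
    then show ?thesis by (subst (asm) infsum_cmult_left') 
  qed
  have contS: "continuous_on {0..1} ?S"
    by (rule has_sum_integral_dominated(2)[OF _ _ dom'(1)]) (auto simp: dom'(2) intro!: contG)
  have contT: "continuous_on {0..1} ?T"
    by (rule has_sum_integral_dominated(2)[OF _ _ hat]) (auto simp: norm_mult intro!: continuous_intros)
  have "?S t - ?T t = 0"
  proof (rule fourier_coefficients_determine_continuous[of "\<lambda>t. ?S t - ?T t", OF _ _ t])
    show "continuous_on {0..1} (\<lambda>t. ?S t - ?T t)"
      by (intro continuous_intros contS contT)
    fix m :: int
    have "integral {0..1} (\<lambda>t. ?S t * cis (2 * pi * of_int m * t) - ?T t * cis (2 * pi * of_int m * t)) = 0"
      by (subst integral_diff) (auto simp: S T intro!: integrable_continuous_interval continuous_intros contS contT)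
    then show "integral {0..1} (\<lambda>t. (?S t - ?T t) * cis (2 * pi * of_int m * t)) = 0"
      by (simp only: left_diff_distrib)
  qed
  then show ?thesis by simp
qed

section \<open>Vanishing of alternating lattice sums\<close>

text \<open>
  Stretching by \<open>c \<ge> 1\<close> separates the integers further, so that \<open>k \<mapsto> \<lfloor>c k\<rfloor>\<close> is injective and each
  stretched tile meets only boundedly many tiles.
\<close>

lemma tile_dominated_dilate:
  assumes dom: "tile_dominated g u" and c: "1 \<le> c"
  shows "tile_dominated (\<lambda>t. g (c * t)) (\<lambda>k. \<Sum>i\<in>{0..\<lceil>c\<rceil>}. u (\<lfloor>c * of_int k\<rfloor> + i))"
  unfolding tile_dominated_def
proof (intro conjI allI ballI)
  have "(\<lambda>k. u (\<lfloor>c * of_int k\<rfloor> + i)) summable_on UNIV" for i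
  proof -
    have "strict_mono (\<lambda>k. \<lfloor>c * of_int k\<rfloor> + i)"
    proof (rule strict_monoI)
      fix k l :: int assume "k < l"
      then have "c * of_int k + c * 1 \<le> c * of_int l"
        unfolding distrib_left[symmetric] using c by (intro mult_left_mono) auto
      then show "\<lfloor>c * of_int k\<rfloor> + i < \<lfloor>c * of_int l\<rfloor> + i" using c by linarith
    qed
    then have inj: "inj (\<lambda>k. \<lfloor>c * of_int k\<rfloor> + i)"
      by (rule strict_mono_imp_inj_on)
    show ?thesis
      using summable_on_reindex[OF inj, of u] summable_on_subset_banach[OF tile_dominatedD(1)[OF dom] subset_UNIV]
      by (simp add: o_def)
  qed
  then show "(\<lambda>k. \<Sum>i\<in>{0..\<lceil>c\<rceil>}. u (\<lfloor>c * of_int k\<rfloor> + i)) summable_on UNIV"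
    by (intro has_sum_imp_summable[OF has_sum_finite_sum[OF has_sum_infsum]])
next
  fix k :: int and t :: real assume t: "t \<in> {0..1}"
  define i where "i = \<lfloor>c * (t + of_int k)\<rfloor> - \<lfloor>c * of_int k\<rfloor>"
  have "0 \<le> c * t" "c * t \<le> c * 1" using t c by (auto intro: mult_left_mono)
  then have i: "i \<in> {0..\<lceil>c\<rceil>}" unfolding i_def distrib_left by auto linarith+
  have "cmod (g (c * (t + of_int k))) \<le> u (\<lfloor>c * of_int k\<rfloor> + i)"
    using tile_dominatedD(4)[OF dom, of "c * (t + of_int k)"] by (simp add: i_def)
  also have "\<dots> \<le> (\<Sum>i\<in>{0..\<lceil>c\<rceil>}. u (\<lfloor>c * of_int k\<rfloor> + i))"
    using i tile_dominatedD(3)[OF dom] by (intro member_le_sum) auto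
  finally show "cmod (g (c * (t + of_int k))) \<le> \<dots>" .
qed

lemma has_sum_residue_classes:
  fixes f :: "int \<Rightarrow> 'a :: {comm_monoid_add, topological_comm_monoid_add}" and N :: int
  assumes N: "0 < N" and S: "\<And>r. r \<in> {0..<N} \<Longrightarrow> ((\<lambda>l. f (N * l + r)) has_sum S r) UNIV"
  shows "(f has_sum (\<Sum>r\<in>{0..<N}. S r)) UNIV"
proof -
  have "(f has_sum S r) (range (\<lambda>l. N * l + r))" if "r \<in> {0..<N}" for r
    using S[OF that] N by (subst has_sum_reindex) (auto simp: inj_on_def o_def)
  moreover have "range (\<lambda>l. N * l + r) \<inter> range (\<lambda>l. N * l + s) = {}" 
    if "r \<in> {0..<N}" "s \<in> {0..<N}" "r \<noteq> s" for r s
  proof -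
    have "r = s" if "N * l + r = N * m + s" for l m
    proof -
      have "(N * l + r) mod N = (N * m + s) mod N" using that by simp
      then show ?thesis using \<open>r \<in> {0..<N}\<close> \<open>s \<in> {0..<N}\<close> by simp
    qed
    then show ?thesis using that by auto
  qed
  ultimately have "(f has_sum (\<Sum>r\<in>{0..<N}. S r)) (\<Union>r\<in>{0..<N}. range (\<lambda>l. N * l + r))"
    by (intro sum_has_sum) auto
  moreover have "(\<Union>r\<in>{0..<N}. range (\<lambda>l. N * l + r)) = UNIV"
  proof -
    have "k \<in> range (\<lambda>l. N * l + k mod N)" for k
      by (rule range_eqI[of _ _ "k div N"]) simp
    then show ?thesis using N by (auto simp: set_eq_iff) (metis Euclidean_Rings.pos_mod_bound Euclidean_Rings.pos_mod_sign atLeastLessThan_iff rangeE)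
  qed
  ultimately show ?thesis by simp
qed

definition alt_sign :: "int \<Rightarrow> complex" where
  "alt_sign j = (if even j then 1 else - 1)"

lemma cmod_alt_sign [simp]: "cmod (alt_sign j) = 1"
  by (simp add: alt_sign_def)

lemma alt_sign_diff: "alt_sign (i - j) = alt_sign i * alt_sign j"
  by (auto simp: alt_sign_def)

lemma cis_pi_int: "cis (pi * of_int j) = alt_sign j"
proof (cases "even j")
  case True
  then obtain m where "j = 2 * m" by blast
  then show ?thesis using cis_multiple_2pi[of "of_int m"] by (simp add: alt_sign_def mult_ac)
next
  case False
  then obtain m where "j = 2 * m + 1" by (rule oddE)
  then have "cis (pi * of_int j) = cis (2 * pi * of_int m) * cis pi"
    by (subst cis_mult) (simp add: algebra_simps)
  then show ?thesis using False cis_multiple_2pi[of "of_int m"] by (simp add: alt_sign_def mult_ac)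
qed

definition alternating_sum :: "(real \<Rightarrow> complex) \<Rightarrow> real \<Rightarrow> complex" where
  "alternating_sum G x = (\<Sum>\<^sub>\<infinity>j. alt_sign j * G (x + of_int j))"

lemma alternating_sum_has_sum:
  assumes "tile_dominated G v" "x \<in> {0..1}"
  shows "((\<lambda>j. alt_sign j * G (x + of_int j)) has_sum alternating_sum G x) UNIV"
    and "(\<lambda>j. cmod (alt_sign j * G (x + of_int j))) summable_on UNIV"
proof -
  show *: "(\<lambda>j. cmod (alt_sign j * G (x + of_int j))) summable_on UNIV"
    by (rule summable_on_comparison_test[OF tile_dominatedD(1)[OF assms(1)]])
      (use tile_dominatedD(2)[OF assms] in \<open>auto simp: norm_mult\<close>)
  show "((\<lambda>j. alt_sign j * G (x + of_int j)) has_sum alternating_sum G x) UNIV"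
    unfolding alternating_sum_def by (rule has_sum_infsum) (rule abs_summable_summable[OF *])
qed

text \<open>
  Poisson summation for \<open>g (\<surd>N t) exp (-\<i> \<pi> t)\<close>: the twist produces the signs on one side and moves
  the dual lattice by half a step on the other. With the scale \<open>\<surd>N\<close> the dual lattice is \<open>N\<close> times
  as dense as the original one, and its residue classes modulo \<open>N\<close> are translates of the original
  lattice; hence the right-hand side involves the same sums.
\<close>

lemma alternating_sum_fourier_system:
  fixes N :: int
  assumes cont: "continuous_on UNIV g" and dom: "tile_dominated g u"
    and eigen: "\<And>\<gamma>. fourier g \<gamma> = - g \<gamma>" and N: "0 < N" and r: "r \<in> {0..<N}"
  defines "G \<equiv> \<lambda>t. g (sqrt N * t)" and "x \<equiv> \<lambda>r::int. (of_int r + 1/2) / of_int N"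
  shows "alternating_sum G (x r) =
    - (\<Sum>s\<in>{0..<N}. cis (2 * pi * (of_int s + 1/2) * x r) * alternating_sum G (x s)) / of_real (sqrt N)"
proof -
  define v where "v k = (\<Sum>i\<in>{0..\<lceil>sqrt N\<rceil>}. u (\<lfloor>sqrt N * of_int k\<rfloor> + i))" for k :: int
  have sqrtN: "sqrt N \<ge> 1" using N by simp
  have domG: "tile_dominated G v"
    unfolding G_def v_def using tile_dominated_dilate[OF dom sqrtN] .
  have x01: "0 < x s" "x s < 1" "x s \<in> {0..1}" if "s \<in> {0..<N}" for s
    using that N by (auto simp: x_def field_simps)
  define H where "H t = G t * cis (- (pi * t))" for t
  have contH: "continuous_on UNIV H"
    unfolding H_def G_def by (intro continuous_intros continuous_on_compose2[OF cont]) auto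
  have domH: "tile_dominated H v"
    using domG by (simp add: tile_dominated_def H_def norm_mult)
  have hatH: "fourier H k = - G ((k + 1/2) / of_int N) / of_real (sqrt N)" for k
  proof -
    have "fourier g ((k + 1/2) / sqrt N) = (LINT y|lborel. g y * cis (- (2 * pi * ((k + 1/2) / sqrt N) * y)))"
      by (rule fourier_eq_cis)
    also have "\<dots> = sqrt N *\<^sub>R (LINT t|lborel. g (0 + sqrt N * t) * cis (- (2 * pi * ((k + 1/2) / sqrt N) * (0 + sqrt N * t))))"
      using sqrtN N by (subst lborel_integral_real_affine[where c = "sqrt N" and t = 0]) simp_all
    also have "(LINT t|lborel. g (0 + sqrt N * t) * cis (- (2 * pi * ((k + 1/2) / sqrt N) * (0 + sqrt N * t)))) = fourier H k"
      unfolding fourier_eq_cis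
    proof (rule Bochner_Integration.integral_cong[OF refl])
      fix t
      have "2 * pi * ((k + 1/2) / sqrt N) * (sqrt N * t) = pi * t + 2 * pi * k * t"
        using sqrtN by (simp add: field_simps)
      then have "cis (- (2 * pi * ((k + 1/2) / sqrt N) * (sqrt N * t))) = cis (- (pi * t)) * cis (- (2 * pi * k * t))"
        by (simp add: cis_mult)
      then show "g (0 + sqrt N * t) * cis (- (2 * pi * ((k + 1/2) / sqrt N) * (0 + sqrt N * t))) = H t * cis (- (2 * pi * k * t))"
        by (simp add: H_def G_def)
    qed
    finally have "of_real (sqrt N) * fourier H k = - g ((k + 1/2) / sqrt N)"
      by (simp add: eigen scaleR_conv_of_real)
    moreover have "(k + 1/2) / sqrt N = sqrt N * ((k + 1/2) / of_int N)"
    proof -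
      have "(k + 1/2) / s = s * ((k + 1/2) / (s * s))" if "1 \<le> s" for s :: real
        using that by (simp add: field_simps)
      from this[OF sqrtN] show ?thesis using N by simp
    qed
    ultimately have "of_real (sqrt N) * fourier H k = - G ((k + 1/2) / of_int N)"
      by (simp add: G_def)
    then show ?thesis using sqrtN N by (simp add: field_simps)
  qed
  have index: "(of_int (N * l + s) + 1/2) / of_int N = x s + of_int l" for l s
    using N by (simp add: x_def field_simps)
  have hat_summable: "(\<lambda>k::int. cmod (fourier H (of_int k))) summable_on UNIV"
  proof -
    have "((\<lambda>l. cmod (fourier H (of_int (N * l + s)))) has_sum (\<Sum>\<^sub>\<infinity>l. cmod (fourier H (of_int (N * l + s))))) UNIV"
      if "s \<in> {0..<N}" for s
    proof (rule has_sum_infsum)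
      show "(\<lambda>l. cmod (fourier H (of_int (N * l + s)))) summable_on UNIV"
      proof -
        have "(\<lambda>l. cmod (G (x s + of_int l))) summable_on UNIV"
          by (rule summable_on_comparison_test[OF tile_dominatedD(1)[OF domG]])
            (use tile_dominatedD(2)[OF domG x01(3)[OF that]] in auto)
        from summable_on_cmult_right[OF this, of "inverse (sqrt N)"] show ?thesis
          unfolding hatH index norm_divide norm_minus_cancel using N by (simp add: divide_inverse mult.commute)
      qed
    qed
    from has_sum_residue_classes[OF N this] show ?thesis by (rule has_sum_imp_summable)
  qed
  let ?T = "\<lambda>k::int. fourier H (of_int k) * cis (2 * pi * of_int k * x r)"
  have T: "((\<lambda>l. ?T (N * l + s)) has_sum
      - cis (- (pi * x r)) / of_real (sqrt N) * (cis (2 * pi * (of_int s + 1/2) * x r) * alternating_sum G (x s))) UNIV"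
    if s: "s \<in> {0..<N}" for s
  proof -
    have "?T (N * l + s) = - cis (- (pi * x r)) / of_real (sqrt N) * (cis (2 * pi * (of_int s + 1/2) * x r) *
        (alt_sign l * G (x s + of_int l)))" for l
    proof -
      have "2 * pi * of_int (N * l + s) * x r = - (pi * x r) + 2 * pi * (of_int s + 1/2) * x r + pi * of_int l + 2 * pi * of_int (l * r)"
        using N by (simp add: x_def field_simps)
      then have "cis (2 * pi * of_int (N * l + s) * x r) =
          cis (- (pi * x r)) * cis (2 * pi * (of_int s + 1/2) * x r) * cis (pi * of_int l) * cis (2 * pi * of_int (l * r))"
        by (simp only: cis_mult)
      also have "cis (2 * pi * of_int (l * r)) = 1"
        using cis_multiple_2pi[of "of_int (l * r)"] by (simp add: mult_ac)
      finally show ?thesis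
        unfolding hatH index cis_pi_int by (simp add: mult_ac)
    qed
    then show ?thesis
      by (simp only:) (intro has_sum_cmult_right alternating_sum_has_sum(1)[OF domG x01(3)[OF s]])
  qed
  have "cis (- (pi * x r)) * alternating_sum G (x r) = (\<Sum>\<^sub>\<infinity>j. H (x r + of_int j))"
  proof -
    have "H (x r + of_int j) = cis (- (pi * x r)) * (alt_sign j * G (x r + of_int j))" for j
    proof -
      have "cis (- (pi * (x r + of_int j))) = cis (- (pi * x r)) * cis (pi * of_int (- j))"
        by (simp add: cis_mult algebra_simps)
      then show ?thesis unfolding H_def cis_pi_int by (simp add: alt_sign_def)
    qed
    then show ?thesis by (simp add: alternating_sum_def infsum_cmult_right')
  qed
  also have "\<dots> = (\<Sum>\<^sub>\<infinity>k. ?T k)"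
    using poisson_summation[OF contH domH hat_summable x01(1,2)[OF r]] by simp
  also have "\<dots> = (\<Sum>s\<in>{0..<N}. - cis (- (pi * x r)) / of_real (sqrt N) * (cis (2 * pi * (of_int s + 1/2) * x r) * alternating_sum G (x s)))"
    using has_sum_residue_classes[OF N T] by (rule infsumI)
  also have "\<dots> = cis (- (pi * x r)) * (- (\<Sum>s\<in>{0..<N}. cis (2 * pi * (of_int s + 1/2) * x r) * alternating_sum G (x s)) / of_real (sqrt N))"
    by (simp add: sum_distrib_left sum_divide_distrib sum_negf)
  finally show ?thesis unfolding mult_cancel_left by simp
qed

text \<open>
  The system above reads \<open>P = - M P\<close>, and \<open>-1\<close> is not an eigenvalue of \<open>M\<close> for these two values of \<open>N\<close>.
  All entries of \<open>M\<close> are powers of \<open>w = exp (\<i> \<pi> / (2N))\<close> divided by \<open>\<surd>N\<close>, and with explicit radicals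
  for \<open>w\<close> the linear system is solved by elimination.
\<close>

lemma alternating_sums_vanish:
  fixes N :: int
  assumes cont: "continuous_on UNIV g" and dom: "tile_dominated g u"
    and eigen: "\<And>\<gamma>. fourier g \<gamma> = - g \<gamma>" and N: "N = 2 \<or> N = 3" and r: "r \<in> {0..<N}"
  shows "alternating_sum (\<lambda>t. g (sqrt N * t)) ((of_int r + 1/2) / of_int N) = 0"
proof -
  define P where "P r = alternating_sum (\<lambda>t. g (sqrt N * t)) ((of_int r + 1/2) / of_int N)" for r :: int
  define w where "w = cis (pi / (2 * of_int N))"
  have power: "cis (2 * pi * (of_int s + 1/2) * ((of_int r + 1/2) / of_int N)) = w ^ nat ((2 * s + 1) * (2 * r + 1))"
    if "0 \<le> s" "0 \<le> r" for r s
  proof -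
    have "2 * pi * (of_int s + 1/2) * ((of_int r + 1/2) / of_int N) = real (nat ((2 * s + 1) * (2 * r + 1))) * (pi / (2 * of_int N))"
      using that N by (auto simp: field_simps)
    then show ?thesis unfolding w_def Complex.DeMoivre by (rule arg_cong)
  qed
  have sys: "of_real (sqrt N) * P r = - (\<Sum>s\<in>{0..<N}. w ^ nat ((2 * s + 1) * (2 * r + 1)) * P s)" if "r \<in> {0..<N}" for r
  proof -
    have "P r = - (\<Sum>s\<in>{0..<N}. cis (2 * pi * (of_int s + 1/2) * ((of_int r + 1/2) / of_int N)) * P s) / of_real (sqrt N)"
      unfolding P_def by (rule alternating_sum_fourier_system[OF cont dom eigen _ that]) (use N in auto)
    also have "(\<Sum>s\<in>{0..<N}. cis (2 * pi * (of_int s + 1/2) * ((of_int r + 1/2) / of_int N)) * P s) =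
        (\<Sum>s\<in>{0..<N}. w ^ nat ((2 * s + 1) * (2 * r + 1)) * P s)"
      by (intro sum.cong refl, subst power) (use that in auto)
    finally show ?thesis using N by (auto simp: field_simps)
  qed
  have "P r = 0"
    using N
  proof
    assume N: "N = 2"
    have w: "w = (1 + \<i>) / of_real (sqrt 2)"
      by (simp add: w_def N complex_eq_iff cos_45 sin_45 field_simps)
    have s2: "of_real (sqrt 2) * of_real (sqrt 2) = (2 :: complex)"
      by (simp flip: of_real_mult)
    have w2: "w ^ 2 = \<i>"
      unfolding w power_divide by (simp add: power2_eq_square s2 algebra_simps)
    have w3: "w ^ 3 = \<i> * w" and w9: "w ^ 9 = w"
    proof -
      show "w ^ 3 = \<i> * w" using w2 by (simp add: eval_nat_numeral)
      have "w ^ 9 = (w ^ 2) ^ 4 * w" by (simp flip: power_mult power_Suc2)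
      then show "w ^ 9 = w" by (simp add: w2)
    qed
    have sw: "of_real (sqrt 2) * w = 1 + \<i>" by (simp add: w)
    have e: "{0..<2::int} = {0, 1}" by auto
    have "of_real (sqrt 2) * (of_real (sqrt 2) * P 0) = - (of_real (sqrt 2) * w * P 0 + \<i> * (of_real (sqrt 2) * w) * P 1)"
         "of_real (sqrt 2) * (of_real (sqrt 2) * P 1) = - (\<i> * (of_real (sqrt 2) * w) * P 0 + of_real (sqrt 2) * w * P 1)"
    proof -
      have "of_real (sqrt 2) * P 0 = - (w * P 0 + \<i> * w * P 1)" "of_real (sqrt 2) * P 1 = - (\<i> * w * P 0 + w * P 1)"
        using sys[of 0] sys[of 1] by (simp_all add: N e w3 w9)
      then show "of_real (sqrt 2) * (of_real (sqrt 2) * P 0) = - (of_real (sqrt 2) * w * P 0 + \<i> * (of_real (sqrt 2) * w) * P 1)"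
         "of_real (sqrt 2) * (of_real (sqrt 2) * P 1) = - (\<i> * (of_real (sqrt 2) * w) * P 0 + of_real (sqrt 2) * w * P 1)"
        by (simp_all only:) (simp_all add: algebra_simps)
    qed
    then have "2 * P 0 = - ((1 + \<i>) * P 0 + \<i> * (1 + \<i>) * P 1)"
              "2 * P 1 = - (\<i> * (1 + \<i>) * P 0 + (1 + \<i>) * P 1)"
      unfolding sw mult.assoc[symmetric] s2 by simp_all
    then have eq: "(3 + \<i>) * P 0 = (1 - \<i>) * P 1" "(3 + \<i>) * P 1 = (1 - \<i>) * P 0"
      by (simp_all add: complex_eq_iff)
    have vanish: "(8 + 8 * \<i>) * x = 0" if "(3 + \<i>) * x = (1 - \<i>) * y" "(3 + \<i>) * y = (1 - \<i>) * x" for x y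
    proof -
      have "(3 + \<i>) * ((3 + \<i>) * x) = (1 - \<i>) * ((3 + \<i>) * y)"
        by (simp only: that(1) mult.left_commute)
      also have "\<dots> = (1 - \<i>) * ((1 - \<i>) * x)" by (simp only: that(2))
      finally show ?thesis by (simp add: algebra_simps)
    qed
    have "(8 + 8 * \<i>) * P 0 = 0" "(8 + 8 * \<i>) * P 1 = 0"
      by (rule vanish[OF eq], rule vanish[OF eq(2,1)])
    moreover have "8 + 8 * \<i> \<noteq> 0" by (simp add: complex_eq_iff)
    ultimately have "P 0 = 0" "P 1 = 0" by simp_all
    moreover have "r = 0 \<or> r = 1" using r N by auto
    ultimately show ?thesis by auto
  next
    assume N: "N = 3"
    define q where "q = complex_of_real (sqrt 3)"
    have q2: "q * q = 3" by (simp add: q_def flip: of_real_mult)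
    have w: "w = (q + \<i>) / 2"
      by (simp add: w_def N q_def complex_eq_iff cos_30 sin_30)
    have w2: "w ^ 2 = (1 + \<i> * q) / 2"
      unfolding w power_divide using q2 by (simp add: power2_eq_square algebra_simps)
    have w3: "w ^ 3 = \<i>"
    proof -
      have "w ^ 3 = w ^ 2 * w" by (simp add: eval_nat_numeral)
      then show ?thesis unfolding w2 unfolding w using q2 by (simp add: algebra_simps)
    qed
    have "w ^ 5 = w ^ 3 * w ^ 2" "w ^ 9 = (w ^ 3) ^ 3" "w ^ 15 = (w ^ 3) ^ 5" "w ^ 25 = (w ^ 3) ^ 8 * w"
      by (simp_all flip: power_mult power_add power_Suc2)
    then have w5: "w ^ 5 = (\<i> - q) / 2" and w9: "w ^ 9 = - \<i>" and w15: "w ^ 15 = \<i>" and w25: "w ^ 25 = w"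
      unfolding w2 w3 by (simp_all add: algebra_simps eval_nat_numeral)
    have e: "{0..<3::int} = {0, 1, 2}" by auto
    have eqs: "q * P 0 = - ((q + \<i>) / 2 * P 0 + \<i> * P 1 + (\<i> - q) / 2 * P 2)"
         "q * P 1 = - (\<i> * P 0 - \<i> * P 1 + \<i> * P 2)"
         "q * P 2 = - ((\<i> - q) / 2 * P 0 + \<i> * P 1 + (q + \<i>) / 2 * P 2)"
      using sys[of 0] sys[of 1] sys[of 2] by (simp_all add: N e w3 w5 w9 w15 w25 flip: q_def) (simp_all add: w)
    have q0: "q \<noteq> 0" by (simp add: q_def)
    have eqs2: "2 * (q * P 0) = - ((q + \<i>) * P 0 + 2 * \<i> * P 1 + (\<i> - q) * P 2)"
         "2 * (q * P 2) = - ((\<i> - q) * P 0 + 2 * \<i> * P 1 + (q + \<i>) * P 2)"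
      by (subst eqs, simp add: field_simps)+
    have neg: "z = 0" if "z = - z" for z :: complex
      using that by (simp add: complex_eq_iff)
    have "2 * (q * P 0) - 2 * (q * P 2) = - (2 * (q * P 0) - 2 * (q * P 2))"
      by (subst (1 2) eqs2) (simp add: algebra_simps)
    from neg[OF this] have P2: "P 2 = P 0" using q0 by simp
    have "2 * (q * P 0) = 2 * (- \<i> * (P 0 + P 1))" using eqs2(1) unfolding P2 by (simp add: algebra_simps)
    then have "q * P 0 = - \<i> * (P 0 + P 1)" by (simp only: mult_cancel_left) simp
    then have "\<i> * (q * P 0) = \<i> * (- \<i> * (P 0 + P 1))" by (simp only:)
    also have "\<dots> = P 0 + P 1" by (simp add: algebra_simps)
    finally have "\<i> * (q * P 0) = P 0 + P 1" .
    then have P1: "P 1 = (\<i> * q - 1) * P 0" by (simp add: algebra_simps)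
    have "q * P 1 = - \<i> * (2 * P 0 - P 1)" using eqs(2) unfolding P2 by (simp add: algebra_simps)
    then have "(q * q * \<i> + 3 * \<i>) * P 0 = 0" unfolding P1 by (simp add: algebra_simps)
    then have "P 0 = 0" by (simp add: q2)
    moreover have "r = 0 \<or> r = 1 \<or> r = 2" using r N by auto
    ultimately show ?thesis using P1 P2 by auto
  qed
  then show ?thesis by (simp add: P_def)
qed

section \<open>Box sums of a null series\<close>

text \<open>
  Shifting a window by \<open>i\<close> alters it only near its two ends, over a length of \<open>2 \<bar>i\<bar>\<close> at each; the
  second bound counts the points of both windows and serves for large shifts.
\<close>

lemma card_window_symm_diff:
  fixes i R :: int
  assumes "0 \<le> R" and L: "finite L"
  defines "A \<equiv> {l \<in> L. (\<bar>i + l\<bar> \<le> R) \<noteq> (\<bar>l\<bar> \<le> R)}"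
  shows "int (card A) \<le> 4 * \<bar>i\<bar>" and "int (card A) \<le> 4 * R + 2"
proof -
  have "A \<subseteq> {- R - \<bar>i\<bar>..<- R + \<bar>i\<bar>} \<union> {R - \<bar>i\<bar><..R + \<bar>i\<bar>}"
    by (auto simp: A_def)
  then have "card A \<le> card ({- R - \<bar>i\<bar>..<- R + \<bar>i\<bar>} \<union> {R - \<bar>i\<bar><..R + \<bar>i\<bar>})"
    by (intro card_mono) auto
  also have "\<dots> \<le> card {- R - \<bar>i\<bar>..<- R + \<bar>i\<bar>} + card {R - \<bar>i\<bar><..R + \<bar>i\<bar>}"
    by (rule card_Un_le)
  finally show "int (card A) \<le> 4 * \<bar>i\<bar>" by simp
  have "A \<subseteq> {- R - i..R - i} \<union> {- R..R}"
    by (auto simp: A_def)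
  then have "card A \<le> card ({- R - i..R - i} \<union> {- R..R})"
    by (intro card_mono) auto
  also have "\<dots> \<le> card {- R - i..R - i} + card {- R..R}"
    by (rule card_Un_le)
  finally show "int (card A) \<le> 4 * R + 2" using assms(1) by simp
qed

text \<open>
  As \<open>H\<close> has sum zero, one may subtract the full sum from the window sum whenever \<open>\<bar>l\<bar> \<le> R\<close>. Then
  \<open>H i\<close> enters only for those \<open>l\<close> for which exactly one of \<open>l\<close> and \<open>i + l\<close> lies in the window. For a
  fixed \<open>i\<close> the number of such \<open>l\<close> is bounded independently of \<open>R\<close>, and the tail of \<open>H\<close> is small, so
  that the \<open>\<ell>\<^sup>1\<close> norm of the window sums is \<open>o(R)\<close>. One factor of each square is bounded by the
  \<open>\<ell>\<^sup>1\<close> norm \<open>S\<close> of \<open>H\<close>.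
\<close>

lemma box_sums_of_null_series_small:
  fixes H :: "int \<Rightarrow> complex"
  assumes H: "(H has_sum 0) UNIV" and abs: "(\<lambda>i. cmod (H i)) summable_on UNIV" and \<eta>: "0 < \<eta>"
  shows "\<exists>R0. \<forall>R\<ge>R0. \<forall>L. finite L \<longrightarrow>
    (\<Sum>l\<in>L. (cmod (\<Sum>j\<in>{- int R..int R}. H (j - l)))\<^sup>2) \<le> \<eta> * (2 * real R + 1)"
proof -
  define S where "S = (\<Sum>\<^sub>\<infinity>i. cmod (H i))"
  have S0: "0 \<le> S" unfolding S_def by (rule infsum_nonneg) auto
  have sub: "(\<lambda>i. cmod (H i)) summable_on A" for A
    by (rule summable_on_subset_banach[OF abs]) auto
  \<comment> \<open>Keeps \<open>2 S \<theta>\<close>, the share of the tail per unit of box length, below \<open>\<eta> / 2\<close>; adding \<open>1\<close>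
    covers \<open>S = 0\<close>.\<close>
  define \<theta> where "\<theta> = \<eta> / (4 * (S + 1))"
  have \<theta>: "0 < \<theta>" using \<eta> S0 by (simp add: \<theta>_def)
  obtain F where F: "finite F" "(\<Sum>\<^sub>\<infinity>i\<in>-F. cmod (H i)) \<le> \<theta>"
  proof -
    obtain F where F: "finite F" "dist (\<Sum>i\<in>F. cmod (H i)) S \<le> \<theta>"
      using infsum_finite_approximation[OF abs \<theta>] unfolding S_def by auto
    have "S = infsum (\<lambda>i. cmod (H i)) (F \<union> - F)" by (simp add: S_def)
    also have "\<dots> = (\<Sum>i\<in>F. cmod (H i)) + (\<Sum>\<^sub>\<infinity>i\<in>-F. cmod (H i))"
      using F(1) by (subst infsum_Un_disjoint) (auto intro: sub)
    finally have "(\<Sum>\<^sub>\<infinity>i\<in>-F. cmod (H i)) \<le> \<theta>" using F(2) by (simp add: dist_real_def)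
    then show ?thesis using that F by blast
  qed
  obtain M where M: "\<And>i. i \<in> F \<Longrightarrow> \<bar>i\<bar> \<le> M" "0 \<le> M"
  proof (rule that[of "\<Sum>i\<in>F. \<bar>i\<bar>"])
    show "\<bar>i\<bar> \<le> (\<Sum>i\<in>F. \<bar>i\<bar>)" if "i \<in> F" for i
      using that F(1) by (intro member_le_sum) auto
  qed (auto intro: sum_nonneg)
  obtain R0 :: nat where R0: "8 * of_int M * S\<^sup>2 / \<eta> \<le> R0"
    using real_arch_simple by blast
  show ?thesis
  proof (intro exI[of _ R0] allI impI)
    fix R :: nat and L :: "int set" assume R: "R0 \<le> R" and L: "finite L"
    define y where "y l = (\<Sum>j\<in>{- int R..int R}. H (j - l))" for l
    define d where "d i l = (of_bool ((\<bar>i + l\<bar> \<le> int R) \<noteq> (\<bar>l\<bar> \<le> int R)) :: real)" for i l :: int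
    have y_window: "y l = (\<Sum>i\<in>{- int R - l..int R - l}. H i)" for l
      unfolding y_def by (rule sum.reindex_bij_witness[of _ "\<lambda>i. i + l" "\<lambda>j. j - l"]) auto
    have y_le_S: "cmod (y l) \<le> S" for l
      unfolding y_window S_def
      by (rule order_trans[OF norm_sum]) (rule finite_sum_le_infsum[OF abs], auto)
    have d_summable: "(\<lambda>i. cmod (H i) * d i l) summable_on A" for l A
      by (rule summable_on_comparison_test[OF sub]) (auto simp: d_def)
    have y_le: "cmod (y l) \<le> (\<Sum>\<^sub>\<infinity>i. cmod (H i) * d i l)" for l
    proof -
      have "((\<lambda>i. if \<bar>i + l\<bar> \<le> int R then H i else 0) has_sum y l) UNIV"
        unfolding y_window by (rule has_sum_finite_neutralI[of "{- int R - l..int R - l}"]) (auto intro!: sum.cong)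
      moreover have "((\<lambda>i. if \<bar>l\<bar> \<le> int R then H i else 0) has_sum 0) UNIV"
        using H by (cases "\<bar>l\<bar> \<le> int R") simp_all
      ultimately have "((\<lambda>i. (if \<bar>i + l\<bar> \<le> int R then H i else 0) - (if \<bar>l\<bar> \<le> int R then H i else 0)) has_sum (y l - 0)) UNIV"
        by (rule has_sum_diff)
      then have "((\<lambda>i. (if \<bar>i + l\<bar> \<le> int R then H i else 0) - (if \<bar>l\<bar> \<le> int R then H i else 0)) has_sum y l) UNIV"
        by simp
      moreover have "(\<lambda>i. cmod ((if \<bar>i + l\<bar> \<le> int R then H i else 0) - (if \<bar>l\<bar> \<le> int R then H i else 0))) = (\<lambda>i. cmod (H i) * d i l)"
        by (rule ext) (auto simp: d_def)
      ultimately show ?thesis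
        by (intro norm_has_sum_bound[where f = "\<lambda>i. (if \<bar>i + l\<bar> \<le> int R then H i else 0) - (if \<bar>l\<bar> \<le> int R then H i else 0)"])
          (simp_all add: has_sum_infsum[OF d_summable])
    qed
    have d_sum: "((\<lambda>i. \<Sum>l\<in>L. cmod (H i) * d i l) has_sum (\<Sum>l\<in>L. \<Sum>\<^sub>\<infinity>i\<in>A. cmod (H i) * d i l)) A" for A
      by (intro has_sum_finite_sum has_sum_infsum d_summable)
    have "(\<Sum>l\<in>L. (cmod (y l))\<^sup>2) \<le> (\<Sum>l\<in>L. S * cmod (y l))"
      unfolding power2_eq_square by (intro sum_mono mult_right_mono y_le_S) auto
    also have "\<dots> \<le> S * (\<Sum>l\<in>L. \<Sum>\<^sub>\<infinity>i. cmod (H i) * d i l)"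
      unfolding sum_distrib_left[symmetric] by (intro mult_left_mono sum_mono y_le S0)
    also have "(\<Sum>l\<in>L. \<Sum>\<^sub>\<infinity>i. cmod (H i) * d i l) = (\<Sum>\<^sub>\<infinity>i. \<Sum>l\<in>L. cmod (H i) * d i l)"
      using infsumI[OF d_sum[of UNIV]] by simp
    also have "\<dots> \<le> (\<Sum>\<^sub>\<infinity>i\<in>F. 4 * of_int M * cmod (H i)) + (\<Sum>\<^sub>\<infinity>i\<in>-F. (4 * real R + 2) * cmod (H i))"
    proof -
      have sd: "(\<Sum>l\<in>L. cmod (H i) * d i l) = cmod (H i) * real (card {l\<in>L. (\<bar>i + l\<bar> \<le> int R) \<noteq> (\<bar>l\<bar> \<le> int R)})" for i
        unfolding sum_distrib_left[symmetric] d_def using L by (simp add: Int_def)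
      have card1: "real (card {l\<in>L. (\<bar>i + l\<bar> \<le> int R) \<noteq> (\<bar>l\<bar> \<le> int R)}) \<le> 4 * of_int M" if "i \<in> F" for i
      proof -
        have "int (card {l\<in>L. (\<bar>i + l\<bar> \<le> int R) \<noteq> (\<bar>l\<bar> \<le> int R)}) \<le> 4 * M"
          using card_window_symm_diff(1)[of "int R" L i] L M(1)[OF that] by linarith
        then have "real_of_int (int (card {l\<in>L. (\<bar>i + l\<bar> \<le> int R) \<noteq> (\<bar>l\<bar> \<le> int R)})) \<le> real_of_int (4 * M)"
          by (simp only: of_int_le_iff)
        then show ?thesis by simp
      qed
      have card2: "real (card {l\<in>L. (\<bar>i + l\<bar> \<le> int R) \<noteq> (\<bar>l\<bar> \<le> int R)}) \<le> 4 * real R + 2" for i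
      proof -
        have "real_of_int (int (card {l\<in>L. (\<bar>i + l\<bar> \<le> int R) \<noteq> (\<bar>l\<bar> \<le> int R)})) \<le> real_of_int (4 * int R + 2)"
          using card_window_symm_diff(2)[of "int R" L i] L by (simp only: of_int_le_iff)
        then show ?thesis by simp
      qed
      have "(\<Sum>\<^sub>\<infinity>i. \<Sum>l\<in>L. cmod (H i) * d i l) = (\<Sum>\<^sub>\<infinity>i\<in>F \<union> -F. \<Sum>l\<in>L. cmod (H i) * d i l)" by simp
      also have "\<dots> = (\<Sum>\<^sub>\<infinity>i\<in>F. \<Sum>l\<in>L. cmod (H i) * d i l) + (\<Sum>\<^sub>\<infinity>i\<in>-F. \<Sum>l\<in>L. cmod (H i) * d i l)"
        by (rule infsum_Un_disjoint) (auto intro: has_sum_imp_summable[OF d_sum])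
      also have "\<dots> \<le> (\<Sum>\<^sub>\<infinity>i\<in>F. 4 * of_int M * cmod (H i)) + (\<Sum>\<^sub>\<infinity>i\<in>-F. (4 * real R + 2) * cmod (H i))"
      proof (intro add_mono infsum_mono summable_on_cmult_right sub has_sum_imp_summable[OF d_sum])
        show "(\<Sum>l\<in>L. cmod (H i) * d i l) \<le> 4 * of_int M * cmod (H i)" if "i \<in> F" for i
          unfolding sd using mult_right_mono[OF card1[OF that] norm_ge_zero[of "H i"]] by (simp add: mult.commute)
        show "(\<Sum>l\<in>L. cmod (H i) * d i l) \<le> (4 * real R + 2) * cmod (H i)" for i
          unfolding sd using mult_right_mono[OF card2[of i] norm_ge_zero[of "H i"]] by (simp add: mult.commute)
      qed
      finally show ?thesis .
    qed
    also have "\<dots> = 4 * of_int M * (\<Sum>\<^sub>\<infinity>i\<in>F. cmod (H i)) + (4 * real R + 2) * (\<Sum>\<^sub>\<infinity>i\<in>-F. cmod (H i))"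
      by (simp only: infsum_cmult_right')
    also have "\<dots> \<le> 4 * of_int M * S + (4 * real R + 2) * \<theta>"
      using F M(2) unfolding S_def
      by (intro add_mono mult_left_mono infsum_mono2 sub) auto
    finally have "(\<Sum>l\<in>L. (cmod (y l))\<^sup>2) \<le> S * (4 * of_int M * S + (4 * real R + 2) * \<theta>)"
      using S0 by (simp add: mult_left_mono)
    also have "\<dots> = 4 * of_int M * S\<^sup>2 + S * \<theta> * 2 * (2 * real R + 1)"
      by (simp add: algebra_simps power2_eq_square)
    also have "\<dots> \<le> \<eta> / 2 * (2 * real R + 1) + \<eta> / 2 * (2 * real R + 1)"
    proof (rule add_mono)
      have "8 * of_int M * S\<^sup>2 \<le> \<eta> * R0"
        using R0 \<eta> by (simp add: field_simps)
      also have "\<dots> \<le> \<eta> * (2 * real R + 1)" using \<eta> R by (intro mult_left_mono) auto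
      finally show "4 * of_int M * S\<^sup>2 \<le> \<eta> / 2 * (2 * real R + 1)" by simp
      have "S * \<theta> * 2 \<le> \<eta> / 2"
        using S0 \<eta> by (simp add: \<theta>_def field_simps)
      then show "S * \<theta> * 2 * (2 * real R + 1) \<le> \<eta> / 2 * (2 * real R + 1)"
        by (intro mult_right_mono) auto
    qed
    finally show "(\<Sum>l\<in>L. (cmod (\<Sum>j\<in>{- int R..int R}. H (j - l)))\<^sup>2) \<le> \<eta> * (2 * real R + 1)"
      by (simp add: y_def field_simps)
  qed
qed

section \<open>Bessel's inequality on a unit interval\<close>

lemma set_integral_cis_int:
  fixes k :: int
  shows "(LINT t:{a..<a + 1}|lborel. cis (2 * pi * of_int k * t)) = (if k = 0 then 1 else 0)"
proof -
  have "(LINT t:{a..<a + 1}|lborel. cis (2 * pi * of_int k * t)) = (LINT t:{a..a + 1}|lborel. cis (2 * pi * of_int k * t))"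
  proof -
    have [measurable]: "(\<lambda>t. cis (2 * pi * of_int k * t)) \<in> borel_measurable borel"
      by (intro borel_measurable_continuous_onI continuous_intros)
    show ?thesis
      unfolding set_lebesgue_integral_def using AE_lborel_singleton[of "a + 1"]
      by (intro integral_cong_AE) (measurable, auto simp: indicator_def elim!: eventually_mono)
  qed
  also have "\<dots> = integral {a..a + 1} (\<lambda>t. cis (2 * pi * of_int k * t))"
    by (intro set_borel_integral_eq_integral borel_integrable_atLeastAtMost' continuous_intros)
  finally show ?thesis by (simp only: integral_cis_int)
qed

text \<open>
  Expand the square in the nonnegative integral of \<open>\<bar>z - w S\<bar>\<^sup>2\<close>, where \<open>S\<close> is the partial Fourier sum
  and \<open>w\<close> is the indicator of the interval.
\<close>

lemma bessel_inequality_unit_interval: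
  fixes z :: "real \<Rightarrow> complex" and M :: "int set"
  assumes z: "integrable lborel z" and z2: "integrable lborel (\<lambda>t. (cmod (z t))\<^sup>2)"
    and supp: "\<And>t. t \<notin> {a..<a + 1} \<Longrightarrow> z t = 0" and M: "finite M"
  shows "(\<Sum>m\<in>M. (cmod (LINT t|lborel. z t * cis (- (2 * pi * of_int m * t))))\<^sup>2) \<le> (LINT t|lborel. (cmod (z t))\<^sup>2)"
proof -
  define c where "c m = (LINT t|lborel. z t * cis (- (2 * pi * of_int m * t)))" for m :: int
  define w :: "real \<Rightarrow> complex" where "w t = (if t \<in> {a..<a + 1} then 1 else 0)" for t
  define S where "S t = (\<Sum>m\<in>M. c m * cis (2 * pi * of_int m * t))" for t
  have cis_meas [measurable]: "(\<lambda>t. cis (r * t)) \<in> borel_measurable borel" for r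
    by (intro borel_measurable_continuous_onI continuous_intros)
  have [measurable]: "z \<in> borel_measurable lborel" "w \<in> borel_measurable lborel"
    using z unfolding w_def by measurable
  have int_zc: "integrable lborel (\<lambda>t. z t * cis (- (2 * pi * of_int m * t)))" for m :: int
    by (rule Bochner_Integration.integrable_bound[OF z]) 
      (use cis_meas[of "- (2 * pi * of_int m)"] in \<open>auto simp: norm_mult\<close>)
  have int_w: "integrable lborel (\<lambda>t. w t * cis (2 * pi * of_int k * t))"
    and lint_w: "(LINT t|lborel. w t * cis (2 * pi * of_int k * t)) = (if k = 0 then 1 else 0)" for k :: int
  proof -
    have eq: "w t * cis (2 * pi * of_int k * t) = indicator {a..<a + 1} t *\<^sub>R cis (2 * pi * of_int k * t)" for t
      by (simp add: w_def indicator_def)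
    show "integrable lborel (\<lambda>t. w t * cis (2 * pi * of_int k * t))"
      unfolding eq set_integrable_def[symmetric]
      by (rule set_integrable_subset[OF borel_integrable_atLeastAtMost'[of a "a + 1"]]) (auto intro!: continuous_intros)
    show "(LINT t|lborel. w t * cis (2 * pi * of_int k * t)) = (if k = 0 then 1 else 0)"
      unfolding eq set_lebesgue_integral_def[symmetric] by (rule set_integral_cis_int)
  qed
  define C where "C = (\<Sum>m\<in>M. c m * cnj (c m))"
  have zS: "has_bochner_integral lborel (\<lambda>t. z t * cnj (S t)) C"
  proof -
    have "has_bochner_integral lborel (\<lambda>t. \<Sum>m\<in>M. cnj (c m) * (z t * cis (- (2 * pi * of_int m * t)))) (\<Sum>m\<in>M. cnj (c m) * c m)"
      unfolding c_def by (intro has_bochner_integral_sum has_bochner_integral_mult_right has_bochner_integral_integrable int_zc)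
    moreover have "(\<lambda>t. \<Sum>m\<in>M. cnj (c m) * (z t * cis (- (2 * pi * of_int m * t)))) = (\<lambda>t. z t * cnj (S t))"
      by (simp add: S_def sum_distrib_left cis_cnj mult_ac)
    ultimately show ?thesis by (simp only: C_def mult.commute)
  qed
  have Sz: "has_bochner_integral lborel (\<lambda>t. cnj (z t) * S t) C"
  proof -
    have "cnj C = C" by (simp add: C_def mult.commute)
    then show ?thesis
      using has_bochner_integral_bounded_linear[OF bounded_linear_cnj zS] by simp
  qed
  have SS: "has_bochner_integral lborel (\<lambda>t. w t * S t * cnj (S t)) C"
  proof -
    have "has_bochner_integral lborel (\<lambda>t. \<Sum>m\<in>M. \<Sum>n\<in>M. c m * cnj (c n) * (w t * cis (2 * pi * of_int (m - n) * t)))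
       (\<Sum>m\<in>M. \<Sum>n\<in>M. c m * cnj (c n) * (LINT t|lborel. w t * cis (2 * pi * of_int (m - n) * t)))"
      by (intro has_bochner_integral_sum has_bochner_integral_mult_right has_bochner_integral_integrable int_w)
    moreover have "(\<Sum>m\<in>M. \<Sum>n\<in>M. c m * cnj (c n) * (LINT t|lborel. w t * cis (2 * pi * of_int (m - n) * t))) = C"
      unfolding lint_w C_def using M by (simp add: if_distrib sum.delta cong: if_cong)
    moreover have "(\<Sum>m\<in>M. \<Sum>n\<in>M. c m * cnj (c n) * (w t * cis (2 * pi * of_int (m - n) * t))) = w t * S t * cnj (S t)" for t
    proof -
      have "cis (2 * pi * of_int (m - n) * t) = cis (2 * pi * of_int m * t) * cnj (cis (2 * pi * of_int n * t))" for m n :: int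
        by (simp add: cis_cnj cis_mult algebra_simps)
      note cis = this
      have "w t * S t * cnj (S t) = w t * (\<Sum>m\<in>M. \<Sum>n\<in>M. (c m * cis (2 * pi * of_int m * t)) * cnj (c n * cis (2 * pi * of_int n * t)))"
        unfolding S_def cnj_sum sum_product mult.assoc[of "w t"] by (rule refl)
      then show ?thesis
        unfolding cis sum_distrib_left by (simp only: complex_cnj_mult mult_ac)
    qed
    ultimately show ?thesis by simp
  qed
  have zz: "has_bochner_integral lborel (\<lambda>t. z t * cnj (z t)) (of_real (LINT t|lborel. (cmod (z t))\<^sup>2))"
    using has_bochner_integral_of_real[OF has_bochner_integral_integrable[OF z2], where 'a = complex]
    by (simp only: complex_norm_square)
  have "has_bochner_integral lborel (\<lambda>t. z t * cnj (z t) - z t * cnj (S t) - cnj (z t) * S t + w t * S t * cnj (S t))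
      (of_real (LINT t|lborel. (cmod (z t))\<^sup>2) - C - C + C)"
    by (intro has_bochner_integral_add has_bochner_integral_diff zz zS Sz SS)
  moreover have "z t * cnj (z t) - z t * cnj (S t) - cnj (z t) * S t + w t * S t * cnj (S t) =
      of_real ((cmod (z t - w t * S t))\<^sup>2)" for t
    unfolding complex_norm_square using supp[of t] by (auto simp: w_def algebra_simps)
  moreover have "of_real (LINT t|lborel. (cmod (z t))\<^sup>2) - C - C + C =
      complex_of_real ((LINT t|lborel. (cmod (z t))\<^sup>2) - (\<Sum>m\<in>M. (cmod (c m))\<^sup>2))"
    unfolding C_def of_real_diff of_real_sum complex_norm_square by simp
  ultimately have "has_bochner_integral lborel (\<lambda>t. complex_of_real ((cmod (z t - w t * S t))\<^sup>2))
      (complex_of_real ((LINT t|lborel. (cmod (z t))\<^sup>2) - (\<Sum>m\<in>M. (cmod (c m))\<^sup>2)))"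
    by simp
  from has_bochner_integral_bounded_linear[OF bounded_linear_Re this]
  have "has_bochner_integral lborel (\<lambda>t. (cmod (z t - w t * S t))\<^sup>2)
      ((LINT t|lborel. (cmod (z t))\<^sup>2) - (\<Sum>m\<in>M. (cmod (c m))\<^sup>2))"
    by (simp only: Re_complex_of_real)
  from has_bochner_integral_integral_eq[OF this]
  have "(LINT t|lborel. (cmod (z t))\<^sup>2) - (\<Sum>m\<in>M. (cmod (c m))\<^sup>2) = (LINT t|lborel. (cmod (z t - w t * S t))\<^sup>2)"
    by simp
  also have "\<dots> \<ge> 0" by (rule Bochner_Integration.integral_nonneg) simp
  finally show ?thesis by (simp add: c_def)
qed

section \<open>Test functions that defeat the lower frame bound\<close>

text \<open>
  Frame sums of a subfamily are smaller, so test functions for the full family also defeat the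
  lower frame bound of any subfamily.
\<close>

lemma not_frame_of_small_test_functions:
  fixes \<phi> :: "'i \<Rightarrow> real \<Rightarrow> complex" and h :: "'j \<Rightarrow> 'i"
  assumes small: "\<And>\<eta>. 0 < \<eta> \<Longrightarrow> \<exists>f\<in>L2. 0 < L2_norm f \<and>
      (\<forall>F. finite F \<longrightarrow> (\<Sum>i\<in>F. (cmod (L2_inner f (\<phi> i)))\<^sup>2) \<le> \<eta> * (L2_norm f)\<^sup>2)"
    and h: "inj h"
  shows "\<not> L2_frame (\<lambda>j. \<phi> (h j))"
proof
  assume "L2_frame (\<lambda>j. \<phi> (h j))"
  then obtain A where A: "0 < A" and frame: "\<And>f. f \<in> L2 \<Longrightarrow>
      (\<lambda>j. (cmod (L2_inner f (\<phi> (h j))))\<^sup>2) summable_on UNIV \<and>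
      A * (L2_norm f)\<^sup>2 \<le> (\<Sum>\<^sub>\<infinity>j. (cmod (L2_inner f (\<phi> (h j))))\<^sup>2)"
    unfolding L2_frame_def by blast
  obtain f where f: "f \<in> L2" "0 < L2_norm f" and
    le: "\<And>F. finite F \<Longrightarrow> (\<Sum>i\<in>F. (cmod (L2_inner f (\<phi> i)))\<^sup>2) \<le> A / 2 * (L2_norm f)\<^sup>2"
    using small[of "A / 2"] A by auto
  have "(\<Sum>\<^sub>\<infinity>j. (cmod (L2_inner f (\<phi> (h j))))\<^sup>2) \<le> A / 2 * (L2_norm f)\<^sup>2"
  proof (rule infsum_le_finite_sums)
    show "(\<lambda>j. (cmod (L2_inner f (\<phi> (h j))))\<^sup>2) summable_on UNIV" using frame[OF f(1)] by blast
    fix F :: "'j set" assume "finite F"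
    then show "(\<Sum>j\<in>F. (cmod (L2_inner f (\<phi> (h j))))\<^sup>2) \<le> A / 2 * (L2_norm f)\<^sup>2"
      using le[of "h ` F"] by (simp add: sum.reindex[OF inj_on_subset[OF h subset_UNIV]])
  qed
  moreover have "A / 2 * (L2_norm f)\<^sup>2 < A * (L2_norm f)\<^sup>2"
    using A f(2) by (intro mult_strict_right_mono) auto
  ultimately show False using frame[OF f(1)] by linarith
qed

lemma tail_sum_small:
  fixes W :: "int \<Rightarrow> real"
  assumes W: "W summable_on UNIV" and nonneg: "\<And>l. 0 \<le> W l" and e: "0 < e"
  shows "\<exists>L0. finite L0 \<and> (\<forall>L. finite L \<longrightarrow> L \<inter> L0 = {} \<longrightarrow> (\<Sum>l\<in>L. W l) \<le> e)"
proof -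
  obtain L0 where L0: "finite L0" "dist (\<Sum>i\<in>L0. W i) (infsum W UNIV) \<le> e"
    using infsum_finite_approximation[OF W e] by auto
  have "(\<Sum>l\<in>L. W l) \<le> e" if "finite L" "L \<inter> L0 = {}" for L
  proof -
    have "(\<Sum>l\<in>L \<union> L0. W l) \<le> infsum W UNIV"
      using that L0 nonneg by (intro finite_sum_le_infsum[OF W]) auto
    moreover have "(\<Sum>l\<in>L \<union> L0. W l) = (\<Sum>l\<in>L. W l) + (\<Sum>l\<in>L0. W l)"
      using that L0 by (intro sum.union_disjoint) auto
    ultimately show ?thesis using L0(2) by (simp add: dist_real_def)
  qed
  then show ?thesis using L0(1) by blast
qed

definition comb_sum :: "nat \<Rightarrow> (real \<Rightarrow> complex) \<Rightarrow> real \<Rightarrow> complex" where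
  "comb_sum R G x = (\<Sum>j\<in>{- int R..int R}. alt_sign j * G (x + of_int j))"

text \<open>
  Write \<open>k = N l - r\<close>. At the point \<open>t0\<close> itself the sums over one class \<open>r\<close> are the window sums of the
  null series \<open>(-1)\<^sup>j G (j + (r + 1/2)/N)\<close>, which fixes \<open>R\<close>. For this \<open>R\<close> the sums are dominated by a
  summable sequence uniformly near \<open>t0\<close>, so that all but finitely many \<open>l\<close> are negligible; for the
  remaining ones continuity provides \<open>\<epsilon>\<close>.
\<close>

lemma comb_sums_square_small:
  fixes N :: int
  assumes cont: "continuous_on UNIV G" and dom: "tile_dominated G v" and N: "0 < N"
    and vanish: "\<And>r. r \<in> {0..<N} \<Longrightarrow> alternating_sum G ((of_int r + 1/2) / of_int N) = 0" and \<eta>: "0 < \<eta>"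
  defines "t0 \<equiv> 1 / (2 * real_of_int N)"
  shows "\<exists>R \<epsilon>. 0 < \<epsilon> \<and> \<epsilon> \<le> 1 \<and> (\<forall>K t. finite K \<longrightarrow> t0 \<le> t \<longrightarrow> t < t0 + \<epsilon> \<longrightarrow>
      (\<Sum>k\<in>K. (cmod (comb_sum R G (t - of_int k / of_int N)))\<^sup>2) \<le> \<eta> * (2 * real R + 1))"
proof -
  define x where "x r = (of_int r + 1/2) / real_of_int N" for r :: int
  \<comment> \<open>One share for each of the \<open>N\<close> classes and, within a class, for the null series, the
    continuity error and the tail.\<close>
  define \<theta> where "\<theta> = \<eta> / (3 * of_int N)"
  have \<theta>: "0 < \<theta>" using \<eta> N by (simp add: \<theta>_def)
  have x01: "x r \<in> {0..1}" if "r \<in> {0..<N}" for r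
    using that N by (auto simp: x_def field_simps)
  have "\<exists>R0. \<forall>R\<ge>R0. \<forall>L. finite L \<longrightarrow> (\<Sum>l\<in>L. (cmod (comb_sum R G (x r - of_int l)))\<^sup>2) \<le> \<theta> * (2 * real R + 1)"
    if r: "r \<in> {0..<N}" for r
  proof -
    have eq: "cmod (comb_sum R G (x r - of_int l)) = cmod (\<Sum>j\<in>{- int R..int R}. alt_sign (j - l) * G (x r + of_int (j - l)))" for R l
    proof -
      have "(\<Sum>j\<in>{- int R..int R}. alt_sign (j - l) * G (x r + of_int (j - l))) = alt_sign l * comb_sum R G (x r - of_int l)"
        unfolding comb_sum_def sum_distrib_left by (intro sum.cong refl) (simp add: alt_sign_diff algebra_simps)
      then show ?thesis by (simp add: norm_mult)
    qed
    show ?thesis unfolding eq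
    proof (rule box_sums_of_null_series_small[OF _ _ \<theta>])
      show "((\<lambda>i. alt_sign i * G (x r + of_int i)) has_sum 0) UNIV"
        using alternating_sum_has_sum(1)[OF dom x01[OF r]] vanish[OF r] by (simp add: x_def)
      show "(\<lambda>i. cmod (alt_sign i * G (x r + of_int i))) summable_on UNIV"
        by (rule alternating_sum_has_sum(2)[OF dom x01[OF r]])
    qed
  qed
  then obtain R0 where R0: "\<And>r R L. r \<in> {0..<N} \<Longrightarrow> R0 r \<le> R \<Longrightarrow> finite L \<Longrightarrow>
      (\<Sum>l\<in>L. (cmod (comb_sum R G (x r - of_int l)))\<^sup>2) \<le> \<theta> * (2 * real R + 1)"
    by metis
  define R where "R = Max (R0 ` {0..<N})"
  have R: "(\<Sum>l\<in>L. (cmod (comb_sum R G (x r - of_int l)))\<^sup>2) \<le> \<theta> * (2 * real R + 1)"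
    if "r \<in> {0..<N}" "finite L" for r L
    using that by (intro R0) (auto simp: R_def)
  define W where "W l = (\<Sum>j\<in>{- int R..int R}. v (j - l))" for l
  have W0: "0 \<le> W l" for l
    unfolding W_def by (intro sum_nonneg tile_dominatedD(3)[OF dom])
  have W_summable: "W summable_on UNIV"
  proof -
    have "(\<lambda>l. v (j - l)) summable_on UNIV" for j
    proof -
      have "bij (\<lambda>l. j - l)" by (rule bij_betw_byWitness[of _ "\<lambda>l. j - l"]) auto
      from summable_on_reindex_bij_betw[OF this, of v] show ?thesis
        using tile_dominatedD(1)[OF dom] by simp
    qed
    then show ?thesis unfolding W_def by (intro has_sum_imp_summable[OF has_sum_finite_sum[OF has_sum_infsum]])
  qed
  have W2_summable: "(\<lambda>l. (W l)\<^sup>2) summable_on UNIV"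
  proof (rule summable_on_comparison_test)
    show "(\<lambda>l. infsum W UNIV * W l) summable_on UNIV" by (rule summable_on_cmult_right[OF W_summable])
    have "W l \<le> infsum W UNIV" for l
      using finite_sum_le_infsum[OF W_summable, of "{l}"] W0 by auto
    then show "(W l)\<^sup>2 \<le> infsum W UNIV * W l" for l
      unfolding power2_eq_square using W0 by (intro mult_right_mono) auto
  qed auto
  have comb_le_W: "cmod (comb_sum R G (s - of_int l)) \<le> W l" if "s \<in> {0..1}" for s l
    unfolding comb_sum_def W_def
  proof (rule order_trans[OF norm_sum sum_mono])
    fix j
    show "cmod (alt_sign j * G (s - of_int l + of_int j)) \<le> v (j - l)"
      using tile_dominatedD(2)[OF dom that, of "j - l"] by (simp add: norm_mult algebra_simps)
  qed
  obtain L0 where L0: "finite L0" "\<And>L. finite L \<Longrightarrow> L \<inter> L0 = {} \<Longrightarrow> (\<Sum>l\<in>L. (W l)\<^sup>2) \<le> \<theta>"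
    using tail_sum_small[OF W2_summable _ \<theta>] by auto
  have cont_comb: "continuous_on UNIV (comb_sum R G)"
    unfolding comb_sum_def by (intro continuous_intros continuous_on_compose2[OF cont]) auto
  have "\<exists>d>0. \<forall>t. t0 \<le> t \<longrightarrow> t < t0 + d \<longrightarrow>
      (\<Sum>l\<in>L0. (cmod (comb_sum R G (t + of_int r / of_int N - of_int l)))\<^sup>2) \<le> \<theta> * (2 * real R + 1) + \<theta>"
    if r: "r \<in> {0..<N}" for r
  proof -
    let ?s = "\<lambda>t. \<Sum>l\<in>L0. (cmod (comb_sum R G (t + of_int r / of_int N - of_int l)))\<^sup>2"
    have "continuous_on UNIV ?s"
      by (intro continuous_intros continuous_on_compose2[OF cont_comb]) auto
    then obtain d where d: "0 < d" "\<And>t. dist t t0 \<le> d \<Longrightarrow> dist (?s t) (?s t0) < \<theta>"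
      by (rule continuous_onE[of UNIV ?s t0 \<theta>]) (use \<theta> in auto)
    have "t0 + of_int r / of_int N = x r" using N by (simp add: t0_def x_def field_simps)
    then have "?s t0 \<le> \<theta> * (2 * real R + 1)" using R[OF r L0(1)] by simp
    then have "?s t \<le> \<theta> * (2 * real R + 1) + \<theta>" if "t0 \<le> t" "t < t0 + d" for t
      using d(2)[of t] that by (simp add: dist_real_def abs_if split: if_splits)
    then show ?thesis using d(1) by blast
  qed
  then obtain d where d: "\<And>r. r \<in> {0..<N} \<Longrightarrow> 0 < d r"
      "\<And>r t. r \<in> {0..<N} \<Longrightarrow> t0 \<le> t \<Longrightarrow> t < t0 + d r \<Longrightarrow>
        (\<Sum>l\<in>L0. (cmod (comb_sum R G (t + of_int r / of_int N - of_int l)))\<^sup>2) \<le> \<theta> * (2 * real R + 1) + \<theta>"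
    by metis
  \<comment> \<open>The bound \<open>t0\<close> keeps \<open>t + r / N\<close> in the unit interval, where \<open>W\<close> dominates.\<close>
  define \<epsilon> where "\<epsilon> = min t0 (Min (d ` {0..<N}))"
  have t0: "0 < t0" "2 * t0 = 1 / of_int N" "t0 \<le> 1" using N by (auto simp: t0_def field_simps)
  have \<epsilon>: "0 < \<epsilon>" "\<epsilon> \<le> 1" "\<epsilon> \<le> t0" "\<And>r. r \<in> {0..<N} \<Longrightarrow> \<epsilon> \<le> d r"
    using t0 d(1) N by (auto simp: \<epsilon>_def min_le_iff_disj intro!: disjI2 Min_le)
  have residue: "(\<Sum>l\<in>L. (cmod (comb_sum R G (t + of_int r / of_int N - of_int l)))\<^sup>2) \<le> 3 * \<theta> * (2 * real R + 1)"
    if r: "r \<in> {0..<N}" and L: "finite L" and t: "t0 \<le> t" "t < t0 + \<epsilon>" for r L t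
  proof -
    have s: "t + of_int r / of_int N \<in> {0..1}"
    proof -
      have "of_int r / of_int N \<le> 1 - 1 / real_of_int N" using r N by (simp add: field_simps)
      moreover have "0 \<le> of_int r / real_of_int N" using r N by simp
      ultimately show ?thesis using t t0 \<epsilon>(3) by auto
    qed
    let ?f = "\<lambda>l. (cmod (comb_sum R G (t + of_int r / of_int N - of_int l)))\<^sup>2"
    have "(\<Sum>l\<in>L. ?f l) \<le> (\<Sum>l\<in>L0 \<union> (L - L0). ?f l)"
      using L L0(1) by (intro sum_mono2) auto
    also have "\<dots> = (\<Sum>l\<in>L0. ?f l) + (\<Sum>l\<in>L - L0. ?f l)"
      using L L0(1) by (intro sum.union_disjoint) auto
    also have "\<dots> \<le> (\<theta> * (2 * real R + 1) + \<theta>) + (\<Sum>l\<in>L - L0. (W l)\<^sup>2)"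
      using d(2)[OF r t(1)] t(2) \<epsilon>(4)[OF r] by (intro add_mono sum_mono power_mono comb_le_W s) auto
    also have "\<dots> \<le> (\<theta> * (2 * real R + 1) + \<theta>) + \<theta>"
      using L by (intro add_left_mono L0(2)) auto
    also have "\<dots> \<le> 3 * \<theta> * (2 * real R + 1)" using \<theta> by (simp add: algebra_simps)
    finally show ?thesis .
  qed
  show ?thesis
  proof (intro exI[of _ R] exI[of _ \<epsilon>] conjI allI impI \<epsilon>(1,2))
    fix K :: "int set" and t assume K: "finite K" and t: "t0 \<le> t" "t < t0 + \<epsilon>"
    let ?f = "\<lambda>k. (cmod (comb_sum R G (t - of_int k / of_int N)))\<^sup>2"
    define L where "L = (\<lambda>k. - ((- k) div N)) ` K"
    let ?i = "\<lambda>(r, l). N * l - r"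
    have "(\<Sum>k\<in>K. ?f k) \<le> (\<Sum>k\<in>?i ` ({0..<N} \<times> L). ?f k)"
    proof (rule sum_mono2)
      show "finite (?i ` ({0..<N} \<times> L))" using K by (auto simp: L_def)
      show "K \<subseteq> ?i ` ({0..<N} \<times> L)"
      proof
        fix k assume "k \<in> K"
        moreover have "N * ((- k) div N) + (- k) mod N = - k" by (rule mult_div_mod_eq)
        then have "k = N * (- ((- k) div N)) - (- k) mod N" unfolding mult_minus_right by linarith
        ultimately show "k \<in> ?i ` ({0..<N} \<times> L)"
          using N by (intro image_eqI[of _ _ "((- k) mod N, - ((- k) div N))"]) (auto simp: L_def)
      qed
    qed auto
    also have "\<dots> \<le> (\<Sum>(r, l)\<in>{0..<N} \<times> L. ?f (N * l - r))"
      using sum_image_le[of "{0..<N} \<times> L" ?f ?i] K by (simp add: L_def case_prod_unfold)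
    also have "\<dots> = (\<Sum>r\<in>{0..<N}. \<Sum>l\<in>L. ?f (N * l - r))"
      by (rule sum.cartesian_product[symmetric])
    also have "\<dots> \<le> (\<Sum>r\<in>{0..<N}. 3 * \<theta> * (2 * real R + 1))"
    proof (rule sum_mono)
      fix r assume r: "r \<in> {0..<N}"
      have "t - of_int (N * l - r) / of_int N = t + of_int r / of_int N - of_int l" for l
        using N by (simp add: field_simps)
      then show "(\<Sum>l\<in>L. ?f (N * l - r)) \<le> 3 * \<theta> * (2 * real R + 1)"
        using residue[OF r _ t, of L] K by (simp only:) (simp add: L_def)
    qed
    also have "\<dots> = \<eta> * (2 * real R + 1)" using N by (simp add: \<theta>_def field_simps)
    finally show "(\<Sum>k\<in>K. ?f k) \<le> \<eta> * (2 * real R + 1)" .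
  qed
qed

text \<open>
  The test function is the truncated and thickened comb, rescaled by \<open>s = \<surd>N\<close>. In the variable
  \<open>t = x / s\<close> the modulations have integer frequencies, so the integrals over all the teeth can be
  moved to the interval \<open>I\<close>; there they add up to Fourier coefficients of the truncated
  alternating sum \<open>comb_sum R G\<close>, and Bessel's inequality applies.
\<close>

lemma gabor_test_functions:
  fixes N :: int
  assumes cont: "continuous_on UNIV g" and dom: "tile_dominated g u" and N: "0 < N"
    and vanish: "\<And>r. r \<in> {0..<N} \<Longrightarrow> alternating_sum (\<lambda>t. g (sqrt N * t)) ((of_int r + 1/2) / of_int N) = 0"
    and \<eta>: "0 < \<eta>"
  shows "\<exists>f\<in>L2. 0 < L2_norm f \<and> (\<forall>F. finite F \<longrightarrow>
    (\<Sum>i\<in>F. (cmod (L2_inner f (gabor_system g (1 / sqrt N) (1 / sqrt N) i)))\<^sup>2) \<le> \<eta> * (L2_norm f)\<^sup>2)"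
proof -
  define s where "s = sqrt N"
  have s: "1 \<le> s" "s * s = of_int N" "0 < s" using N by (auto simp: s_def)
  define G where "G t = g (s * t)" for t
  define v where "v k = (\<Sum>i\<in>{0..\<lceil>s\<rceil>}. u (\<lfloor>s * of_int k\<rfloor> + i))" for k :: int
  have contG: "continuous_on UNIV G"
    unfolding G_def by (intro continuous_intros continuous_on_compose2[OF cont]) auto
  have domG: "tile_dominated G v"
    unfolding G_def v_def by (rule tile_dominated_dilate[OF dom s(1)])
  define t0 where "t0 = 1 / (2 * real_of_int N)"
  have vanish': "alternating_sum G ((of_int r + 1/2) / of_int N) = 0" if "r \<in> {0..<N}" for r
    using vanish[OF that] by (simp add: G_def[abs_def] s_def)
  \<comment> \<open>The frame sum carries a factor \<open>N = s\<^sup>2\<close> from rescaling, the squared norm only a factor \<open>s\<close>.\<close>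
  have "0 < \<eta> / s" using \<eta> s by simp
  from comb_sums_square_small[OF contG domG N vanish' this]
  obtain R \<epsilon> where \<epsilon>: "0 < \<epsilon>" "\<epsilon> \<le> 1" and
    comb: "\<And>K t. finite K \<Longrightarrow> t0 \<le> t \<Longrightarrow> t < t0 + \<epsilon> \<Longrightarrow>
      (\<Sum>k\<in>K. (cmod (comb_sum R G (t - of_int k / of_int N)))\<^sup>2) \<le> \<eta> / s * (2 * real R + 1)"
    unfolding t0_def by blast
  define I where "I = {t0..<t0 + \<epsilon>}"
  define J :: "real \<Rightarrow> complex" where "J t = indicator I t" for t
  define e where "e t = (\<Sum>j\<in>{- int R..int R}. alt_sign j * J (t - of_int j))" for t
  define f where "f x = e (x / s)" for x
  have I_meas [measurable]: "I \<in> sets borel" by (simp add: I_def)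
  have J_int: "has_bochner_integral lborel (\<lambda>t. indicator I t :: real) \<epsilon>"
    using has_bochner_integral_real_indicator[of I lborel] \<epsilon> by (simp add: I_def)
  have shift: "has_bochner_integral lborel (\<lambda>t. F (t - of_int j)) x"
    if "has_bochner_integral lborel F x" for F :: "real \<Rightarrow> 'a :: {banach, second_countable_topology}" and j :: int and x
    using that lborel_has_bochner_integral_real_affine_iff[of 1 F x "- of_int j"] by simp
  have scale: "has_bochner_integral lborel (\<lambda>x. F (x / s)) (s *\<^sub>R x)"
    if "has_bochner_integral lborel F x" for F :: "real \<Rightarrow> 'a :: {banach, second_countable_topology}" and x
    using that lborel_has_bochner_integral_real_affine_iff[of "1 / s" F x 0] s by simp
  have e_norm: "(cmod (e t))\<^sup>2 = (\<Sum>j\<in>{- int R..int R}. indicator I (t - of_int j))" for t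
  proof (cases "\<exists>j\<in>{- int R..int R}. t - of_int j \<in> I")
    case True
    then obtain j where j: "j \<in> {- int R..int R}" "t - of_int j \<in> I" by blast
    \<comment> \<open>The teeth are disjoint because they are at most as long as their distance.\<close>
    have uniq: "i = j" if "t - of_int i \<in> I" for i
    proof -
      have "\<bar>real_of_int i - of_int j\<bar> < 1" using that j \<epsilon> by (auto simp: I_def)
      then show ?thesis by linarith
    qed
    have ind: "indicator I (t - of_int i) = (if i = j then 1 else 0 :: 'a :: zero_neq_one)" for i
    proof (cases "i = j")
      case False
      then have "t - of_int i \<notin> I" using uniq by blast
      then show ?thesis using False by simp
    qed (use j(2) in simp)
    show ?thesis using j by (simp add: e_def J_def ind if_distrib cong: if_cong)
  next
    case False
    then show ?thesis by (simp add: e_def J_def)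
  qed
  have f_norm: "has_bochner_integral lborel (\<lambda>x. (cmod (f x))\<^sup>2) (s * ((2 * real R + 1) * \<epsilon>))"
  proof -
    have "has_bochner_integral lborel (\<lambda>t. \<Sum>j\<in>{- int R..int R}. indicator I (t - of_int j)) (\<Sum>j\<in>{- int R..int R}. \<epsilon>)"
      by (intro has_bochner_integral_sum shift J_int)
    from scale[OF this] show ?thesis by (simp add: f_def e_norm)
  qed
  have f_meas: "f \<in> borel_measurable borel"
    unfolding f_def e_def J_def by measurable
  have f_L2: "f \<in> L2"
    using f_norm f_meas by (auto simp: L2_def has_bochner_integral_iff)
  have norm_sq: "(L2_norm f)\<^sup>2 = s * ((2 * real R + 1) * \<epsilon>)"
    using has_bochner_integral_integral_eq[OF f_norm] s \<epsilon> by (simp add: L2_norm_def)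
  define z where "z k t = J t * cnj (comb_sum R G (t - of_int k / of_int N))" for k :: int and t
  have cont_comb: "continuous_on UNIV (comb_sum R G)"
    unfolding comb_sum_def by (intro continuous_intros continuous_on_compose2[OF contG]) auto
  have integrable_J: "integrable lborel (\<lambda>t. J t * F t)" if "continuous_on UNIV F" for F :: "real \<Rightarrow> complex"
  proof -
    have "set_integrable lborel I F"
      by (rule set_integrable_subset[OF borel_integrable_atLeastAtMost'[of t0 "t0 + \<epsilon>"]])
        (auto simp: I_def intro: continuous_on_subset[OF that])
    moreover have "(\<lambda>t. indicator I t *\<^sub>R F t) = (\<lambda>t. J t * F t)"
      by (auto simp: J_def indicator_def)
    ultimately show ?thesis by (simp only: set_integrable_def)
  qed
  have z_int: "integrable lborel (z k)" for k
    unfolding z_def by (intro integrable_J continuous_intros continuous_on_compose2[OF cont_comb]) auto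
  have z2_eq: "complex_of_real ((cmod (z k t))\<^sup>2) = J t * of_real ((cmod (comb_sum R G (t - of_int k / of_int N)))\<^sup>2)" for k t
    by (simp add: z_def norm_mult power_mult_distrib J_def indicator_def)
  have z2_int: "integrable lborel (\<lambda>t. (cmod (z k t))\<^sup>2)" for k
  proof -
    have "integrable lborel (\<lambda>t. complex_of_real ((cmod (z k t))\<^sup>2))"
      unfolding z2_eq by (intro integrable_J continuous_intros continuous_on_compose2[OF cont_comb]) auto
    then show ?thesis by (simp only: complex_of_real_integrable_eq)
  qed
  have z_supp: "z k t = 0" if "t \<notin> {t0..<t0 + 1}" for k t
    using that \<epsilon> by (auto simp: z_def J_def I_def indicator_def)
  have inner: "L2_inner f (gabor_system g (1 / s) (1 / s) (k, m)) =
      of_real s * (LINT t|lborel. z k t * cis (- (2 * pi * of_int m * t)))" for k m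
  proof -
    let ?T = "\<lambda>j t. J t * (alt_sign j * cnj (G (t - of_int k / of_int N + of_int j)) * cis (- (2 * pi * of_int m * t)))"
    have T_int: "integrable lborel (?T j)" for j
      by (intro integrable_J continuous_intros continuous_on_compose2[OF contG]) auto
    have "has_bochner_integral lborel (\<lambda>t. \<Sum>j\<in>{- int R..int R}. ?T j t) (\<Sum>j\<in>{- int R..int R}. LINT t|lborel. ?T j t)"
      by (intro has_bochner_integral_sum has_bochner_integral_integrable T_int)
    moreover have "(\<Sum>j\<in>{- int R..int R}. ?T j t) = z k t * cis (- (2 * pi * of_int m * t))" for t
    proof -
      have "cnj (alt_sign j) = alt_sign j" for j by (simp add: alt_sign_def)
      then show ?thesis
        by (simp add: z_def comb_sum_def sum_distrib_left sum_distrib_right mult_ac)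
    qed
    ultimately have sum_T: "(LINT t|lborel. z k t * cis (- (2 * pi * of_int m * t))) = (\<Sum>j\<in>{- int R..int R}. LINT t|lborel. ?T j t)"
      by (simp add: has_bochner_integral_integral_eq)
    have "has_bochner_integral lborel (\<lambda>t. \<Sum>j\<in>{- int R..int R}. ?T j (t - of_int j)) (\<Sum>j\<in>{- int R..int R}. LINT t|lborel. ?T j t)"
      by (intro has_bochner_integral_sum shift has_bochner_integral_integrable T_int)
    moreover have "(\<Sum>j\<in>{- int R..int R}. ?T j (t - of_int j)) = e t * (cnj (G (t - of_int k / of_int N)) * cis (- (2 * pi * of_int m * t)))" for t
    proof -
      have "cis (- (2 * pi * of_int m * (t - of_int j))) = cis (- (2 * pi * of_int m * t))" for j
        using cis_add_int_period[of "- m" t "- j"] by simp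
      moreover have "t - of_int j - of_int k / of_int N + of_int j = t - of_int k / of_int N" for j :: int by simp
      ultimately show ?thesis
        unfolding e_def sum_distrib_right by (intro sum.cong refl) (simp only: mult_ac)
    qed
    ultimately have "has_bochner_integral lborel (\<lambda>t. e t * (cnj (G (t - of_int k / of_int N)) * cis (- (2 * pi * of_int m * t))))
        (LINT t|lborel. z k t * cis (- (2 * pi * of_int m * t)))"
      unfolding sum_T by simp
    from has_bochner_integral_integral_eq[OF scale[OF this]]
    have "(LINT x|lborel. f x * (cnj (G (x / s - of_int k / of_int N)) * cis (- (2 * pi * of_int m * (x / s))))) =
      of_real s * (LINT t|lborel. z k t * cis (- (2 * pi * of_int m * t)))"
      by (simp add: f_def scaleR_conv_of_real)
    moreover have "cnj (gabor_system g (1 / s) (1 / s) (k, m) x) = cnj (G (x / s - of_int k / of_int N)) * cis (- (2 * pi * of_int m * (x / s)))" for x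
    proof -
      have "s * (x / s - of_int k / of_int N) = x - 1 / s * of_int k"
      proof -
        have "s * (x / s - of_int k / (s * s)) = x - 1 / s * of_int k" using s(3) by (simp add: field_simps)
        then show ?thesis by (simp only: s(2))
      qed
      moreover have "exp (2 * of_real pi * \<i> * of_real (1 / s * of_int m * x)) = cis (2 * pi * of_int m * (x / s))"
        by (simp add: cis_conv_exp mult_ac)
      ultimately show ?thesis
        by (simp add: gabor_system_def G_def cis_cnj)
    qed
    ultimately show ?thesis by (simp add: L2_inner_def)
  qed
  have "(\<Sum>i\<in>F. (cmod (L2_inner f (gabor_system g (1 / s) (1 / s) i)))\<^sup>2) \<le> \<eta> * (L2_norm f)\<^sup>2" if F: "finite F" for F
  proof -
    let ?K = "fst ` F" and ?M = "snd ` F"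
    let ?c = "\<lambda>k m. LINT t|lborel. z k t * cis (- (2 * pi * of_int m * t))"
    have fin: "finite ?K" "finite ?M" using F by auto
    have "(\<Sum>k\<in>?K. LINT t|lborel. (cmod (z k t))\<^sup>2) = (LINT t|lborel. (\<Sum>k\<in>?K. (cmod (z k t))\<^sup>2))"
      by (rule Bochner_Integration.integral_sum[symmetric]) (rule z2_int)
    also have "\<dots> \<le> (LINT t|lborel. \<eta> / s * (2 * real R + 1) * indicator I t)"
    proof (rule integral_mono)
      show "(\<Sum>k\<in>?K. (cmod (z k t))\<^sup>2) \<le> \<eta> / s * (2 * real R + 1) * indicator I t" for t
        using comb[OF fin(1), of t] by (auto simp: z_def J_def I_def indicator_def)
    qed (use J_int in \<open>auto intro!: Bochner_Integration.integrable_sum z2_int simp: has_bochner_integral_iff\<close>)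
    also have "\<dots> = \<eta> / s * (2 * real R + 1) * \<epsilon>"
      using has_bochner_integral_integral_eq[OF J_int] by simp
    finally have z_bound: "(\<Sum>k\<in>?K. LINT t|lborel. (cmod (z k t))\<^sup>2) \<le> \<eta> / s * (2 * real R + 1) * \<epsilon>" .
    have "(\<Sum>i\<in>F. (cmod (L2_inner f (gabor_system g (1 / s) (1 / s) i)))\<^sup>2)
        \<le> (\<Sum>i\<in>?K \<times> ?M. (cmod (L2_inner f (gabor_system g (1 / s) (1 / s) i)))\<^sup>2)"
      using fin by (intro sum_mono2 subset_fst_snd) auto
    also have "\<dots> = (\<Sum>k\<in>?K. \<Sum>m\<in>?M. (cmod (L2_inner f (gabor_system g (1 / s) (1 / s) (k, m))))\<^sup>2)"
      by (simp add: sum.cartesian_product)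
    also have "\<dots> = of_int N * (\<Sum>k\<in>?K. \<Sum>m\<in>?M. (cmod (?c k m))\<^sup>2)"
      unfolding inner norm_mult power_mult_distrib using s N by (simp add: sum_distrib_left power2_eq_square)
    also have "\<dots> \<le> of_int N * (\<Sum>k\<in>?K. LINT t|lborel. (cmod (z k t))\<^sup>2)"
      using N fin by (intro mult_left_mono sum_mono bessel_inequality_unit_interval[of _ t0] z_int z2_int z_supp) auto
    also have "\<dots> \<le> of_int N * (\<eta> / s * (2 * real R + 1) * \<epsilon>)"
      using N by (intro mult_left_mono z_bound) auto
    also have "\<dots> = \<eta> * (L2_norm f)\<^sup>2"
      unfolding norm_sq s(2)[symmetric] using s(3) by (simp add: field_simps)
    finally show ?thesis .
  qed
  moreover have "0 < L2_norm f"
  proof -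
    have "0 < (L2_norm f)\<^sup>2" unfolding norm_sq using s \<epsilon> by simp
    moreover have "0 \<le> L2_norm f" by (simp add: L2_norm_def)
    ultimately show ?thesis by (auto simp: order.strict_iff_order)
  qed
  ultimately show ?thesis
    unfolding s_def by (intro bexI[of _ f] conjI allI impI f_L2)
qed

lemma gabor_system_subfamily:
  "gabor_system g (of_int p * a) (of_int q * b) = (\<lambda>i. gabor_system g a b ((\<lambda>(k, m). (p * k, q * m)) i))"
  by (auto simp: gabor_system_def fun_eq_iff mult_ac)

text \<open>
  All four parameter pairs have the form \<open>(p/\<surd>N, q/\<surd>N)\<close> with \<open>p, q \<in> {1, 2}\<close>, which makes each system
  a subfamily of the one for the lattice of side \<open>1/\<surd>N\<close>.
\<close>

theorem gabor_not_frame_continuous: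
  assumes cont: "continuous_on UNIV g" and dom: "tile_dominated g u"
    and eigen: "\<And>\<gamma>. fourier g \<gamma> = - g \<gamma>"
    and ab: "(a, b) \<in> {(1 / sqrt 2, 1 / sqrt 2), (1 / sqrt 3, 1 / sqrt 3),
                     (2 / sqrt 3, 1 / sqrt 3), (1 / sqrt 3, 2 / sqrt 3)}"
  shows "\<not> L2_frame (gabor_system g a b)"
proof -
  obtain N p q :: int where N: "N = 2 \<or> N = 3" and pq: "p \<noteq> 0" "q \<noteq> 0"
    and a: "a = of_int p * (1 / sqrt N)" and b: "b = of_int q * (1 / sqrt N)"
  proof -
    consider "a = 1 / sqrt 2" "b = 1 / sqrt 2" | "a = 1 / sqrt 3" "b = 1 / sqrt 3"
      | "a = 2 / sqrt 3" "b = 1 / sqrt 3" | "a = 1 / sqrt 3" "b = 2 / sqrt 3"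
      using ab by auto
    then show ?thesis
    proof cases
      case 1 then show ?thesis using that[of 2 1 1] by simp
    next
      case 2 then show ?thesis using that[of 3 1 1] by simp
    next
      case 3 then show ?thesis using that[of 3 2 1] by simp
    next
      case 4 then show ?thesis using that[of 3 1 2] by simp
    qed
  qed
  have "\<not> L2_frame (\<lambda>i. gabor_system g (1 / sqrt N) (1 / sqrt N) ((\<lambda>(k, m). (p * k, q * m)) i))"
  proof (rule not_frame_of_small_test_functions)
    show "inj (\<lambda>(k, m). (p * k, q * m))" using pq by (auto simp: inj_on_def)
    show "\<exists>f\<in>L2. 0 < L2_norm f \<and> (\<forall>F. finite F \<longrightarrow>
        (\<Sum>i\<in>F. (cmod (L2_inner f (gabor_system g (1 / sqrt N) (1 / sqrt N) i)))\<^sup>2) \<le> \<eta> * (L2_norm f)\<^sup>2)"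
      if "0 < \<eta>" for \<eta>
    proof (rule gabor_test_functions[OF cont dom _ _ that])
      show "0 < N" using N by auto
    qed (rule alternating_sums_vanish[OF cont dom eigen N])
  qed
  then show ?thesis by (simp only: a b gabor_system_subfamily not_False_eq_True)
qed

section \<open>Continuous representatives in the eigenspace\<close>

lemma summable_on_inverse_quadratic_int: "(\<lambda>k::int. 1 / (1 + (real_of_int k)\<^sup>2)) summable_on UNIV"
proof -
  have "summable (\<lambda>n. norm (1 / (1 + (real n)\<^sup>2)))"
  proof (rule summable_comparison_test'[where N = 1])
    show "summable (\<lambda>n. inverse (real n ^ 2))" by (rule inverse_power_summable) auto
    show "norm (norm (1 / (1 + (real n)\<^sup>2))) \<le> inverse (real n ^ 2)" if "1 \<le> n" for n
      using that by (simp add: field_simps add_pos_nonneg)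
  qed
  then have nat: "(\<lambda>n. 1 / (1 + (real n)\<^sup>2)) summable_on UNIV"
    by (rule norm_summable_imp_summable_on)
  have "(\<lambda>k::int. 1 / (1 + (real_of_int k)\<^sup>2)) summable_on range int"
    using nat by (subst summable_on_reindex) (auto simp: o_def)
  moreover have "(\<lambda>k::int. 1 / (1 + (real_of_int k)\<^sup>2)) summable_on range (\<lambda>n. - int n)"
    using nat by (subst summable_on_reindex) (auto simp: o_def inj_on_def)
  moreover have "range int \<union> range (\<lambda>n. - int n) = UNIV"
  proof -
    have "k \<in> range int \<union> range (\<lambda>n. - int n)" for k
      by (cases k rule: int_cases2) auto
    then show ?thesis by blast
  qed
  ultimately show ?thesis by (metis summable_on_union)
qed

lemma quadratic_decay_tile_dominated:
  assumes f: "\<And>x. cmod (f x) \<le> C / (1 + x\<^sup>2)"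
  shows "tile_dominated f (\<lambda>k. 3 * C * (1 / (1 + (of_int k)\<^sup>2)))"
  unfolding tile_dominated_def
proof (intro conjI allI ballI summable_on_cmult_right summable_on_inverse_quadratic_int)
  fix k :: int and t :: real assume t: "t \<in> {0..1}"
  have C: "0 \<le> C" using order_trans[OF norm_ge_zero f[of 0]] by simp
  have pos: "0 < 1 + (t + of_int k)\<^sup>2" "0 < 1 + (real_of_int k)\<^sup>2" by (auto intro: add_pos_nonneg)
  have "t\<^sup>2 \<le> 1" using t by (simp add: power_le_one)
  moreover have "0 \<le> (2 * t + of_int k)\<^sup>2" by simp
  ultimately have "1 + (real_of_int k)\<^sup>2 \<le> 3 * (1 + (t + of_int k)\<^sup>2)"
    using zero_le_power2[of "t + of_int k"] by (simp add: power2_eq_square algebra_simps)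
  then have "C * (1 + (real_of_int k)\<^sup>2) \<le> C * (3 * (1 + (t + of_int k)\<^sup>2))"
    using C by (intro mult_left_mono) auto
  then have "C / (1 + (t + of_int k)\<^sup>2) \<le> 3 * C * (1 / (1 + (of_int k)\<^sup>2))"
    using pos by (simp add: field_simps)
  then show "cmod (f (t + of_int k)) \<le> 3 * C * (1 / (1 + (of_int k)\<^sup>2))"
    using f[of "t + of_int k"] by linarith
qed

lemma L2_cauchy_schwarz:
  assumes f: "f \<in> L2" and h: "h \<in> L2"
  shows "integrable lborel (\<lambda>x. f x * h x)" and "cmod (LINT x|lborel. f x * h x) \<le> L2_norm f * L2_norm h"
proof -
  have meas [measurable]: "f \<in> borel_measurable borel" "h \<in> borel_measurable borel"
    and int: "integrable lborel (\<lambda>x. (cmod (f x))\<^sup>2)" "integrable lborel (\<lambda>x. (cmod (h x))\<^sup>2)"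
    using f h by (auto simp: L2_def)
  show fh: "integrable lborel (\<lambda>x. f x * h x)"
  proof (rule Bochner_Integration.integrable_bound[OF Bochner_Integration.integrable_add[OF int]])
    have "cmod (f x * h x) \<le> norm ((cmod (f x))\<^sup>2 + (cmod (h x))\<^sup>2)" for x
    proof -
      have "2 * cmod (f x) * cmod (h x) \<le> (cmod (f x))\<^sup>2 + (cmod (h x))\<^sup>2"
        by (rule sum_squares_bound)
      moreover have "0 \<le> cmod (f x) * cmod (h x)" by simp
      ultimately show ?thesis unfolding norm_mult real_norm_def by linarith
    qed
    then show "AE x in lborel. norm (f x * h x) \<le> norm ((cmod (f x))\<^sup>2 + (cmod (h x))\<^sup>2)" by simp
  qed simp
  have "ennreal ((LINT x|lborel. cmod (f x * h x))\<^sup>2) = (\<integral>\<^sup>+x. ennreal (cmod (f x)) * ennreal (cmod (h x)) \<partial>lborel)\<^sup>2"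
  proof -
    have "(\<integral>\<^sup>+x. ennreal (cmod (f x)) * ennreal (cmod (h x)) \<partial>lborel) = (\<integral>\<^sup>+x. ennreal (cmod (f x * h x)) \<partial>lborel)"
      by (simp add: norm_mult ennreal_mult)
    also have "\<dots> = ennreal (LINT x|lborel. cmod (f x * h x))"
      by (rule nn_integral_eq_integral[OF integrable_norm[OF fh]]) simp
    finally show ?thesis by (simp add: ennreal_power)
  qed
  also have "\<dots> \<le> (\<integral>\<^sup>+x. ennreal (cmod (f x)) ^ 2 \<partial>lborel) * (\<integral>\<^sup>+x. ennreal (cmod (h x)) ^ 2 \<partial>lborel)"
    by (rule Cauchy_Schwarz_nn_integral) simp_all
  also have "\<dots> = ennreal ((L2_norm f)\<^sup>2 * (L2_norm h)\<^sup>2)"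
  proof -
    have "(\<integral>\<^sup>+x. ennreal (cmod (p x)) ^ 2 \<partial>lborel) = ennreal ((L2_norm p)\<^sup>2)" 
      if "integrable lborel (\<lambda>x. (cmod (p x))\<^sup>2)" for p :: "real \<Rightarrow> complex"
    proof -
      have "(\<integral>\<^sup>+x. ennreal (cmod (p x)) ^ 2 \<partial>lborel) = (\<integral>\<^sup>+x. ennreal ((cmod (p x))\<^sup>2) \<partial>lborel)"
        by (simp add: ennreal_power)
      also have "\<dots> = ennreal (LINT x|lborel. (cmod (p x))\<^sup>2)"
        by (rule nn_integral_eq_integral[OF that]) simp
      finally show ?thesis by (simp add: L2_norm_def)
    qed
    then show ?thesis using int by (simp add: ennreal_mult)
  qed
  finally have "(LINT x|lborel. cmod (f x * h x))\<^sup>2 \<le> (L2_norm f * L2_norm h)\<^sup>2"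
    by (simp add: power_mult_distrib)
  then have "(LINT x|lborel. cmod (f x * h x)) \<le> L2_norm f * L2_norm h"
    by (rule power2_le_imp_le) (simp add: L2_norm_def)
  then show "cmod (LINT x|lborel. f x * h x) \<le> L2_norm f * L2_norm h"
    using integral_norm_bound[of lborel "\<lambda>x. f x * h x"] by linarith
qed

text \<open>
  The half-lines \<open>{..a}\<close> form an intersection-stable generator of the Borel sets, so on each bounded
  window the vanishing of the integral spreads from intervals to all Borel sets.
\<close>

lemma AE_zero_if_interval_integrals_zero:
  fixes h :: "real \<Rightarrow> complex"
  assumes int: "\<And>a b. set_integrable lborel {a..b} h"
    and zero: "\<And>a b. a \<le> b \<Longrightarrow> (LINT x:{a..b}|lborel. h x) = 0"
  shows "AE x in lborel. h x = 0"
proof -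
  have "AE x in lborel. indicator {- real n..real n} x *\<^sub>R h x = 0" for n :: nat
  proof (rule sigma_finite_measure.density_zero[OF lborel.sigma_finite_measure_axioms])
    let ?h = "\<lambda>x. indicator {- real n..real n} x *\<^sub>R h x"
    show int_h: "integrable lborel ?h"
      using int[of "- real n" "real n"] by (simp add: set_integrable_def)
    have set_int: "set_integrable lborel A ?h" if "A \<in> sets borel" for A
      unfolding set_integrable_def by (rule integrable_mult_indicator[OF _ int_h]) (use that in simp)
    have all: "(LINT x|lborel. ?h x) = 0"
      using zero[of "- real n" "real n"] by (simp add: set_lebesgue_integral_def)
    have borel: "B \<in> sets borel" if "B \<in> sigma_sets UNIV (range (\<lambda>a::real. {..a}))" for B
      using that by (simp add: borel_eq_atMost)
    have stable: "Int_stable (range (\<lambda>a::real. {..a}))" "range (\<lambda>a::real. {..a}) \<subseteq> Pow UNIV"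
      by (auto simp: Int_stable_def)
    fix A :: "real set" assume "A \<in> sets lborel"
    then have "A \<in> sigma_sets UNIV (range (\<lambda>a::real. {..a}))"
      by (simp add: borel_eq_atMost)
    with stable show "(LINT x:A|lborel. ?h x) = 0"
    proof (induction A rule: sigma_sets_induct_disjoint)
      case (basic A)
      then obtain a where A: "A = {..a}" by blast
      show ?case
      proof (cases "a < - real n")
        case True
        then have "indicator A x *\<^sub>R ?h x = 0" for x by (auto simp: A indicator_def)
        then show ?thesis unfolding set_lebesgue_integral_def by (simp only: Bochner_Integration.integral_zero)
      next
        case False
        have eq: "indicator A x *\<^sub>R ?h x = indicator {- real n..min a (real n)} x *\<^sub>R h x" for x
          by (auto simp: A indicator_def)
        show ?thesis
          unfolding set_lebesgue_integral_def eq
          using zero[of "- real n" "min a (real n)"] False by (simp add: set_lebesgue_integral_def)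
      qed
    next
      case (compl A)
      have "(LINT x:A \<union> (UNIV - A)|lborel. ?h x) = (LINT x:A|lborel. ?h x) + (LINT x:UNIV - A|lborel. ?h x)"
        using borel[OF compl(1)] by (intro set_integral_Un set_int) auto
      moreover have "A \<union> (UNIV - A) = UNIV" by auto
      moreover have "(LINT x:UNIV|lborel. ?h x) = 0" using all by (simp add: set_lebesgue_integral_def)
      ultimately show ?case using compl(2) by simp
    next
      case (union A)
      have "(LINT x:(\<Union>i. A i)|lborel. ?h x) = (\<Sum>i. (LINT x:A i|lborel. ?h x))"
      proof (rule lebesgue_integral_countable_add)
        show meas: "A i \<in> sets lborel" for i using union(2) borel[of "A i"] by auto
        show "A i \<inter> A j = {}" if "i \<noteq> j" for i j using union(1) that by (auto simp: disjoint_family_on_def)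
        show "set_integrable lborel (\<Union>i. A i) ?h" using meas by (intro set_int) auto
      qed
      then show ?case using union(3) by simp
    qed (simp add: set_lebesgue_integral_def)
  qed
  then have "AE x in lborel. \<forall>n::nat. indicator {- real n..real n} x *\<^sub>R h x = 0"
    unfolding AE_all_countable by (rule allI)
  then show ?thesis
  proof (rule AE_mp, intro AE_I2 impI)
    fix x :: real assume h: "\<forall>n::nat. indicator {- real n..real n} x *\<^sub>R h x = 0"
    obtain n :: nat where "\<bar>x\<bar> \<le> real n" using real_arch_simple by blast
    then have "x \<in> {- real n..real n}" by auto
    then show "h x = 0" using h[rule_format, of n] by simp
  qed
qed

lemma continuous_fourier:
  assumes g: "integrable lborel g"
  shows "continuous_on UNIV (fourier g)"
proof -
  have "isCont (fourier g) a" for a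
    unfolding continuous_at_sequentially
  proof (intro allI impI)
    fix X assume X: "X \<longlonglongrightarrow> a"
    have [measurable]: "g \<in> borel_measurable borel" using g by auto
    have cis_meas [measurable]: "(\<lambda>x. cis (- (2 * pi * c * x))) \<in> borel_measurable borel" for c
      by (intro borel_measurable_continuous_onI continuous_intros)
    show "(fourier g \<circ> X) \<longlonglongrightarrow> fourier g a"
      unfolding o_def fourier_eq_cis
      by (rule integral_dominated_convergence[where w = "\<lambda>x. norm (g x)"])
        (use g in \<open>auto simp: norm_mult intro!: tendsto_intros X\<close>)
  qed
  then show ?thesis by (simp add: continuous_on_eq_continuous_at)
qed

lemma norm_fourier_le: "cmod (fourier g \<gamma>) \<le> (LINT x|lborel. cmod (g x))"
  unfolding fourier_eq_cis using integral_norm_bound[of lborel "\<lambda>x. g x * cis (- (2 * pi * \<gamma> * x))"]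
  by (simp add: norm_mult)

lemma fourier_multiplication_formula:
  assumes f: "integrable lborel f" and h: "integrable lborel h"
  shows "(LINT \<gamma>|lborel. fourier f \<gamma> * h \<gamma>) = (LINT x|lborel. f x * fourier h x)"
proof -
  let ?K = "\<lambda>x \<gamma>. f x * h \<gamma> * cis (- (2 * pi * \<gamma> * x))"
  have [measurable]: "f \<in> borel_measurable borel" "h \<in> borel_measurable borel" using f h by auto
  have [measurable]: "(\<lambda>p. cis (- (2 * pi * snd p * fst p))) \<in> borel_measurable (borel \<Otimes>\<^sub>M borel)"
    unfolding borel_prod by (intro borel_measurable_continuous_onI continuous_intros)
  have "integrable (lborel \<Otimes>\<^sub>M lborel) (case_prod ?K)"
  proof (rule lborel_pair.Fubini_integrable)
    show "case_prod ?K \<in> borel_measurable (lborel \<Otimes>\<^sub>M lborel)"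
      by (simp add: case_prod_unfold)
    have "(LINT \<gamma>|lborel. norm (case_prod ?K (x, \<gamma>))) = cmod (f x) * (LINT \<gamma>|lborel. cmod (h \<gamma>))" for x
      by (simp add: norm_mult)
    then show "integrable lborel (\<lambda>x. LINT \<gamma>|lborel. norm (case_prod ?K (x, \<gamma>)))"
      using f by simp
    show "AE x in lborel. integrable lborel (\<lambda>\<gamma>. case_prod ?K (x, \<gamma>))"
    proof (rule AE_I2)
      fix x
      have [measurable]: "(\<lambda>\<gamma>. cis (- (2 * pi * \<gamma> * x))) \<in> borel_measurable borel"
        by (intro borel_measurable_continuous_onI continuous_intros)
      have "integrable lborel (\<lambda>\<gamma>. f x * (h \<gamma> * cis (- (2 * pi * \<gamma> * x))))"
        by (intro integrable_mult_right Bochner_Integration.integrable_bound[OF h]) (auto simp: norm_mult)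
      then show "integrable lborel (\<lambda>\<gamma>. case_prod ?K (x, \<gamma>))" by (simp add: mult.assoc)
    qed
  qed
  from lborel_pair.Fubini_integral[OF this]
  have "(LINT \<gamma>|lborel. LINT x|lborel. ?K x \<gamma>) = (LINT x|lborel. LINT \<gamma>|lborel. ?K x \<gamma>)" .
  moreover have "(LINT x|lborel. ?K x \<gamma>) = fourier f \<gamma> * h \<gamma>" for \<gamma>
  proof -
    have "?K x \<gamma> = f x * cis (- (2 * pi * \<gamma> * x)) * h \<gamma>" for x by simp
    then show ?thesis by (simp only: fourier_eq_cis integral_mult_left_zero)
  qed
  moreover have "(LINT \<gamma>|lborel. ?K x \<gamma>) = f x * fourier h x" for x
  proof -
    have "?K x \<gamma> = f x * (h \<gamma> * cis (- (2 * pi * x * \<gamma>)))" for \<gamma> by (simp add: mult_ac)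
    then show ?thesis by (simp only: fourier_eq_cis integral_mult_right_zero)
  qed
  ultimately show ?thesis by simp
qed

text \<open>
  The transform is bounded by the length of the interval and, by its explicit form, by
  \<open>1 / (\<pi> \<bar>x\<bar>)\<close>. The combination of both bounds is square integrable.
\<close>

lemma fourier_indicator_bound:
  assumes "a \<le> b"
  shows "(cmod (fourier (indicator {a..b}) x))\<^sup>2 \<le> ((b - a)\<^sup>2 + 1) / (1 + x\<^sup>2)"
proof -
  let ?E = "fourier (indicator {a..b}) x"
  have "cmod ?E \<le> b - a"
  proof -
    have "(\<lambda>t. cmod (indicator {a..b} t)) = indicator {a..b}" by (auto simp: indicator_def)
    then show ?thesis using norm_fourier_le[of "indicator {a..b}" x] assms by simp
  qed
  then have 1: "(cmod ?E)\<^sup>2 \<le> (b - a)\<^sup>2" by (intro power_mono) auto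
  have 2: "(cmod ?E)\<^sup>2 * x\<^sup>2 \<le> 1"
  proof (cases "x = 0")
    case False
    define c where "c = - 2 * pi * x * \<i>"
    have c: "c \<noteq> 0" "cmod c = 2 * pi * \<bar>x\<bar>" using False by (simp_all add: c_def norm_mult)
    have "?E = (LINT t:{a..b}|lborel. cis (- (2 * pi * x * t)))"
      unfolding fourier_eq_cis set_lebesgue_integral_def
      by (intro Bochner_Integration.integral_cong) (auto simp: indicator_def)
    also have "\<dots> = integral {a..b} (\<lambda>t. cis (- (2 * pi * x * t)))"
      by (intro set_borel_integral_eq_integral borel_integrable_atLeastAtMost' continuous_intros)
    also have "\<dots> = cis (- (2 * pi * x * b)) / c - cis (- (2 * pi * x * a)) / c"
    proof (rule integral_unique, rule fundamental_theorem_of_calculus[OF assms])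
      fix t :: real
      have "((\<lambda>t. exp (c * of_real t) / c) has_vector_derivative exp (c * of_real t)) (at t within {a..b})"
        using c by (auto intro!: derivative_eq_intros has_vector_derivative_real_field simp: scaleR_conv_of_real)
      then show "((\<lambda>t. cis (- (2 * pi * x * t)) / c) has_vector_derivative cis (- (2 * pi * x * t))) (at t within {a..b})"
        by (simp add: cis_conv_exp c_def mult_ac)
    qed
    finally have "cmod ?E \<le> 1 / cmod c + 1 / cmod c"
      using norm_triangle_ineq4[of "cis (- (2 * pi * x * b)) / c" "cis (- (2 * pi * x * a)) / c"] by (simp add: norm_divide)
    also have "\<dots> = 1 / (pi * \<bar>x\<bar>)" using False by (simp add: c(2) field_simps)
    finally have "cmod ?E * \<bar>x\<bar> \<le> 1 / (pi * \<bar>x\<bar>) * \<bar>x\<bar>" by (intro mult_right_mono) auto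
    also have "\<dots> \<le> 1" using False pi_gt3 by (simp add: field_simps)
    finally have "(cmod ?E * \<bar>x\<bar>)\<^sup>2 \<le> 1" by (intro power_le_one) auto
    then show ?thesis by (simp add: power_mult_distrib)
  qed simp
  have "(cmod ?E)\<^sup>2 * (1 + x\<^sup>2) \<le> (b - a)\<^sup>2 + 1" using 1 2 by (simp add: algebra_simps)
  then show ?thesis by (simp add: field_simps add_pos_nonneg)
qed

lemma indicator_L1: "integrable lborel (indicator {a..b::real} :: real \<Rightarrow> complex)"
proof -
  have "integrable lborel (indicator {a..b::real} :: real \<Rightarrow> real)"
    by (intro integrable_real_indicator) (auto simp: emeasure_lborel_Icc_eq)
  then have "integrable lborel (\<lambda>x. complex_of_real (indicator {a..b} x))" by (rule integrable_of_real)
  moreover have "(\<lambda>x. complex_of_real (indicator {a..b} x)) = indicator {a..b}" by (auto simp: indicator_def)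
  ultimately show ?thesis by simp
qed

lemma indicator_L2: "indicator {a..b::real} \<in> L2"
proof -
  have "(\<lambda>x. (cmod (indicator {a..b} x))\<^sup>2) = indicator {a..b}" by (auto simp: indicator_def)
  moreover have "integrable lborel (indicator {a..b::real} :: real \<Rightarrow> real)"
    by (intro integrable_real_indicator) (auto simp: emeasure_lborel_Icc_eq)
  ultimately show ?thesis by (simp add: L2_def)
qed

lemma fourier_indicator_L2:
  assumes "a \<le> b"
  shows "fourier (indicator {a..b}) \<in> L2"
proof -
  have meas [measurable]: "fourier (indicator {a..b}) \<in> borel_measurable borel"
    by (intro borel_measurable_continuous_onI continuous_fourier indicator_L1)
  have "tile_dominated (\<lambda>x. complex_of_real ((cmod (fourier (indicator {a..b}) x))\<^sup>2)) (\<lambda>k. 3 * ((b - a)\<^sup>2 + 1) * (1 / (1 + (of_int k)\<^sup>2)))"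
    by (rule quadratic_decay_tile_dominated) (use fourier_indicator_bound[OF assms] in \<open>simp only: norm_of_real abs_of_nonneg[OF zero_le_power2]\<close>)
  then have "integrable lborel (\<lambda>x. complex_of_real ((cmod (fourier (indicator {a..b}) x))\<^sup>2))"
    by (rule tile_dominated_integrable[rotated]) measurable
  then have "integrable lborel (\<lambda>x. (cmod (fourier (indicator {a..b}) x))\<^sup>2)"
    by (simp only: complex_of_real_integrable_eq)
  then show ?thesis by (simp add: L2_def)
qed

lemma L2_diff:
  assumes f: "f \<in> L2" and h: "h \<in> L2"
  shows "(\<lambda>x. f x - h x) \<in> L2"
proof -
  have [measurable]: "f \<in> borel_measurable borel" "h \<in> borel_measurable borel"
    using f h by (auto simp: L2_def)
  have "integrable lborel (\<lambda>x. 2 * (cmod (f x))\<^sup>2 + 2 * (cmod (h x))\<^sup>2)"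
    using f h by (auto simp: L2_def)
  then have "integrable lborel (\<lambda>x. (cmod (f x - h x))\<^sup>2)"
  proof (rule Bochner_Integration.integrable_bound)
    have "(cmod (f x - h x))\<^sup>2 \<le> 2 * (cmod (f x))\<^sup>2 + 2 * (cmod (h x))\<^sup>2" for x
    proof -
      have "(cmod (f x - h x))\<^sup>2 \<le> (cmod (f x) + cmod (h x))\<^sup>2"
        by (intro power_mono norm_triangle_ineq4) auto
      moreover have "0 \<le> (cmod (f x) - cmod (h x))\<^sup>2" by simp
      ultimately show ?thesis by (simp add: power2_eq_square algebra_simps)
    qed
    then show "AE x in lborel. norm ((cmod (f x - h x))\<^sup>2) \<le> norm (2 * (cmod (f x))\<^sup>2 + 2 * (cmod (h x))\<^sup>2)"
      by (intro AE_I2) (simp add: abs_of_nonneg)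
  qed simp
  then show ?thesis by (simp add: L2_def)
qed

lemma L2_limit_integral:
  assumes s: "\<And>n. s n \<in> L2" and f: "f \<in> L2" and h: "h \<in> L2"
    and lim: "(\<lambda>n. L2_norm (\<lambda>x. s n x - f x)) \<longlonglongrightarrow> 0"
  shows "(\<lambda>n. LINT x|lborel. s n x * h x) \<longlonglongrightarrow> (LINT x|lborel. f x * h x)"
proof -
  have lim0: "(\<lambda>n. L2_norm (\<lambda>x. s n x - f x) * L2_norm h) \<longlonglongrightarrow> 0"
    using tendsto_mult_right[OF lim, of "L2_norm h"] by simp
  have le: "norm ((LINT x|lborel. s n x * h x) - (LINT x|lborel. f x * h x)) \<le> L2_norm (\<lambda>x. s n x - f x) * L2_norm h" for n
  proof -
    have "(LINT x|lborel. s n x * h x) - (LINT x|lborel. f x * h x) = (LINT x|lborel. (s n x - f x) * h x)"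
      unfolding left_diff_distrib
      by (rule Bochner_Integration.integral_diff[symmetric]) (intro L2_cauchy_schwarz s f h)+
    then show ?thesis using L2_cauchy_schwarz(2)[OF L2_diff[OF s f] h] by simp
  qed
  have "(\<lambda>n. (LINT x|lborel. s n x * h x) - (LINT x|lborel. f x * h x)) \<longlonglongrightarrow> 0"
    by (rule Lim_null_comparison[OF always_eventually[OF allI[OF le]] lim0])
  then show ?thesis by (simp add: LIM_zero_iff)
qed

text \<open>
  Pair both transforms with the indicator of an interval and move the transform to the indicator
  by the multiplication formula. Since the transform of an indicator is itself in \<open>L2\<close>, this
  pairing is continuous in the \<open>L2\<close> norm, which makes it possible to pass to the limit along the
  sequence that defines the \<open>L2\<close> transform without Plancherel's theorem.
\<close>

lemma L2_fourier_eq_fourier: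
  assumes g: "integrable lborel g" and F: "L2_fourier g F"
  shows "AE x in lborel. fourier g x = F x"
proof -
  have gF: "g \<in> L2" "F \<in> L2" using F by (auto simp: L2_fourier_def)
  obtain s :: "nat \<Rightarrow> real \<Rightarrow> complex" where s: "\<And>n. s n \<in> L1" "\<And>n. s n \<in> L2" "\<And>n. fourier (s n) \<in> L2"
    and lim: "(\<lambda>n. L2_norm (\<lambda>x. s n x - g x)) \<longlonglongrightarrow> 0" "(\<lambda>n. L2_norm (\<lambda>\<gamma>. fourier (s n) \<gamma> - F \<gamma>)) \<longlonglongrightarrow> 0"
    using F unfolding L2_fourier_def by blast
  have cont: "continuous_on UNIV (fourier g)" by (rule continuous_fourier[OF g])
  have int_fg: "integrable lborel (\<lambda>x. fourier g x * indicator {a..b} x)" for a b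
  proof -
    have "set_integrable lborel {a..b} (fourier g)"
      by (rule borel_integrable_atLeastAtMost'[OF continuous_on_subset[OF cont]]) auto
    moreover have "(\<lambda>x. indicator {a..b} x *\<^sub>R fourier g x) = (\<lambda>x. fourier g x * indicator {a..b} x)"
      by (auto simp: indicator_def)
    ultimately show ?thesis by (simp only: set_integrable_def)
  qed
  have int_F: "integrable lborel (\<lambda>x. F x * indicator {a..b} x)" for a b
    by (rule L2_cauchy_schwarz(1)[OF gF(2) indicator_L2])
  have ind: "(\<lambda>x. indicator {a..b} x *\<^sub>R (fourier g x - F x)) = (\<lambda>x. fourier g x * indicator {a..b} x - F x * indicator {a..b} x)" for a b :: real
    by (auto simp: indicator_def)
  have "AE x in lborel. fourier g x - F x = 0"
  proof (rule AE_zero_if_interval_integrals_zero)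
    fix a b :: real
    show "set_integrable lborel {a..b} (\<lambda>x. fourier g x - F x)"
      unfolding set_integrable_def ind by (intro Bochner_Integration.integrable_diff int_fg int_F)
    assume ab: "a \<le> b"
    have "(\<lambda>n. LINT x|lborel. fourier (s n) x * indicator {a..b} x) \<longlonglongrightarrow> (LINT x|lborel. F x * indicator {a..b} x)"
      by (rule L2_limit_integral[OF s(3) gF(2) indicator_L2 lim(2)])
    moreover have "(\<lambda>n. LINT x|lborel. fourier (s n) x * indicator {a..b} x) \<longlonglongrightarrow> (LINT x|lborel. fourier g x * indicator {a..b} x)"
    proof -
      have "(LINT x|lborel. fourier (s n) x * indicator {a..b} x) = (LINT x|lborel. s n x * fourier (indicator {a..b}) x)" for n
        using s(1)[of n] by (intro fourier_multiplication_formula indicator_L1) (simp add: L1_def)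
      then show ?thesis
        unfolding fourier_multiplication_formula[OF g indicator_L1]
        using L2_limit_integral[OF s(2) gF(1) fourier_indicator_L2[OF ab] lim(1)] by simp
    qed
    ultimately have "(LINT x|lborel. F x * indicator {a..b} x) = (LINT x|lborel. fourier g x * indicator {a..b} x)"
      by (rule LIMSEQ_unique)
    then show "(LINT x:{a..b}|lborel. fourier g x - F x) = 0"
      unfolding set_lebesgue_integral_def ind using int_fg int_F by simp
  qed
  then show ?thesis by simp
qed

lemma wiener_space_majorant:
  assumes g: "g \<in> wiener_space"
  obtains u :: "int \<Rightarrow> real" where "u summable_on UNIV" "\<And>k. 0 \<le> u k"
    "AE x in lborel. \<forall>k. x - of_int k \<in> {0..1} \<longrightarrow> cmod (g x) \<le> u k"
proof -
  define e where "e k = esssup (restrict_space lborel {0..1}) (\<lambda>x. ennreal (cmod (g (x + of_int k))))" for k :: int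
  have meas [measurable]: "g \<in> borel_measurable borel" and fin: "(\<Sum>\<^sub>\<infinity>k. e k) < \<infinity>"
    using g by (auto simp: wiener_space_def e_def)
  have sum_le: "sum e A \<le> (\<Sum>\<^sub>\<infinity>k. e k)" if "finite A" for A
    using infsum_mono_neutral[of e A e UNIV] nonneg_summable_on_complete[of UNIV e] that by simp
  have e_fin: "e k < \<infinity>" for k using sum_le[of "{k}"] fin by simp
  define u where "u k = enn2real (e k)" for k
  have ennreal_u: "ennreal (u k) = e k" for k
    using e_fin[of k] by (simp add: u_def)
  have "u summable_on UNIV"
  proof (rule nonneg_bdd_above_summable_on)
    show "bdd_above (sum u ` {F. F \<subseteq> UNIV \<and> finite F})"
    proof (rule bdd_aboveI)
      fix y assume "y \<in> sum u ` {F. F \<subseteq> UNIV \<and> finite F}"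
      then obtain A where A: "finite A" "y = sum u A" by blast
      have "ennreal (sum u A) = (\<Sum>k\<in>A. ennreal (u k))"
        by (rule sum_ennreal[symmetric]) (simp add: u_def)
      also have "\<dots> = sum e A" by (simp only: ennreal_u)
      finally have "ennreal (sum u A) = sum e A" .
      then have "ennreal y \<le> (\<Sum>\<^sub>\<infinity>k. e k)" using sum_le[OF A(1)] A(2) by simp
      then show "y \<le> enn2real (\<Sum>\<^sub>\<infinity>k. e k)"
        using fin enn2real_mono[of "ennreal y" "\<Sum>\<^sub>\<infinity>k. e k"] by (simp add: A(2) sum_nonneg u_def)
    qed
  qed (simp add: u_def)
  moreover have "0 \<le> u k" for k by (simp add: u_def)
  moreover have "AE x in lborel. \<forall>k. x - of_int k \<in> {0..1} \<longrightarrow> cmod (g x) \<le> u k"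
    unfolding AE_all_countable
  proof
    fix k :: int
    have "AE x in restrict_space lborel {0..1}. ennreal (cmod (g (x + of_int k))) \<le> e k"
      unfolding e_def by (rule esssup_AE)
    then have "AE x in lborel. x \<in> {0..1} \<longrightarrow> ennreal (cmod (g (x + of_int k))) \<le> ennreal (u k)"
      unfolding ennreal_u by (subst (asm) AE_restrict_space_iff) auto
    then have "AE x in lborel. x \<in> {0..1} \<longrightarrow> cmod (g (x + of_int k)) \<le> u k"
      by eventually_elim (simp add: u_def)
    from AE_borel_affine[OF _ _ this, of 1 "- of_int k"]
    show "AE x in lborel. x - of_int k \<in> {0..1} \<longrightarrow> cmod (g x) \<le> u k" by simp
  qed
  ultimately show ?thesis by (rule that)
qed

text \<open>
  A continuous function that exceeds \<open>c\<close> at an interior point does so on a nonempty open set, and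
  such a set is not null.
\<close>

lemma AE_le_imp_le_interval:
  fixes f :: "real \<Rightarrow> real"
  assumes cont: "continuous_on UNIV f" and ae: "AE x in lborel. x \<in> {a..b} \<longrightarrow> f x \<le> c"
    and ab: "a < b" and x: "x \<in> {a..b}"
  shows "f x \<le> c"
proof (rule continuous_le_on_closure[where S = "{a<..<b}" and f = f])
  have cl: "closure {a<..<b} = {a..b}" using ab by simp
  show "continuous_on (closure {a<..<b}) f" by (rule continuous_on_subset[OF cont]) auto
  show "x \<in> closure {a<..<b}" using x cl by simp
  fix y assume y: "y \<in> {a<..<b}"
  let ?S = "{a<..<b} \<inter> {y. c < f y}"
  show "f y \<le> c"
  proof (rule ccontr)
    assume "\<not> f y \<le> c"
    then have "?S \<noteq> {}" using y by auto
    moreover have "open ?S"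
      by (intro open_Int open_Collect_less continuous_intros cont open_greaterThanLessThan)
    ultimately have "\<not> negligible ?S" using open_not_negligible by blast
    moreover have "?S \<in> null_sets lborel"
    proof -
      have "AE x in lborel. x \<notin> ?S" using ae by eventually_elim auto
      moreover have "?S \<in> sets lborel" using \<open>open ?S\<close> by simp
      ultimately show ?thesis by (simp add: AE_iff_null_sets)
    qed
    ultimately show False
      by (simp add: negligible_iff_null_sets null_sets_completionI)
  qed
qed

text \<open>
  The representative is \<open>- fourier g\<close>: it is continuous because \<open>g\<close> is integrable, and it agrees with
  \<open>g\<close> almost everywhere because \<open>g\<close> is an eigenfunction for \<open>-1\<close>.
\<close>

lemma continuous_representative:
  assumes "g \<in> fourier_eigenspace 2 \<inter> wiener_space"
  obtains g' u where "continuous_on UNIV g'" "tile_dominated g' u" "\<And>\<gamma>. fourier g' \<gamma> = - g' \<gamma>"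
    "AE x in lborel. g x = g' x" "g \<in> borel_measurable borel" "g' \<in> borel_measurable borel"
proof -
  have g: "g \<in> wiener_space" "L2_fourier g (\<lambda>x. - g x)" and meas [measurable]: "g \<in> borel_measurable borel"
    using assms by (auto simp: fourier_eigenspace_def wiener_space_def)
  obtain u :: "int \<Rightarrow> real" where u: "u summable_on UNIV" "\<And>k. 0 \<le> u k"
    "AE x in lborel. \<forall>k. x - of_int k \<in> {0..1} \<longrightarrow> cmod (g x) \<le> u k"
    using wiener_space_majorant[OF g(1)] by blast
  have int_g: "integrable lborel g"
  proof (rule Bochner_Integration.integrable_bound[OF integrable_floor_sequence[OF u(1,2)]])
    show "AE x in lborel. norm (g x) \<le> norm (u \<lfloor>x\<rfloor>)"
      using u(3)
    proof eventually_elim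
      case (elim x)
      have "x - of_int \<lfloor>x\<rfloor> \<in> {0..1}" by auto linarith
      then have "cmod (g x) \<le> u \<lfloor>x\<rfloor>" using elim by blast
      then show ?case by simp
    qed
  qed simp
  define g' where "g' x = - fourier g x" for x
  have cont: "continuous_on UNIV g'"
    unfolding g'_def by (intro continuous_intros continuous_fourier int_g)
  then have meas' [measurable]: "g' \<in> borel_measurable borel" by (rule borel_measurable_continuous_onI)
  have ae: "AE x in lborel. g x = g' x"
    using L2_fourier_eq_fourier[OF int_g g(2)] by eventually_elim (simp add: g'_def)
  have "cmod (g' x) \<le> u k" if "x \<in> {of_int k..of_int k + 1}" for x k
  proof (rule AE_le_imp_le_interval[where f = "\<lambda>x. cmod (g' x)", OF _ _ _ that])
    show "continuous_on UNIV (\<lambda>x. cmod (g' x))" by (intro continuous_intros cont)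
    show "AE x in lborel. x \<in> {of_int k..of_int k + 1} \<longrightarrow> cmod (g' x) \<le> u k"
      using u(3) ae by eventually_elim (auto simp: algebra_simps)
  qed simp
  then have dom: "tile_dominated g' u"
    using u(1) by (auto simp: tile_dominated_def)
  have "fourier g' \<gamma> = - g' \<gamma>" for \<gamma>
  proof -
    have [measurable]: "(\<lambda>x. cis (- (2 * pi * \<gamma> * x))) \<in> borel_measurable borel"
      by (intro borel_measurable_continuous_onI continuous_intros)
    have "fourier g' \<gamma> = fourier g \<gamma>"
      unfolding fourier_eq_cis using ae by (intro integral_cong_AE) (measurable, auto)
    then show ?thesis by (simp add: g'_def)
  qed
  then show ?thesis by (rule that[OF cont dom _ ae meas meas'])
qed

lemma L2_frame_gabor_AE_cong:
  assumes ae: "AE x in lborel. g x = g' x" and [measurable]: "g \<in> borel_measurable borel" "g' \<in> borel_measurable borel"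
  shows "L2_frame (gabor_system g a b) = L2_frame (gabor_system g' a b)"
proof -
  have inner: "L2_inner f (gabor_system g a b i) = L2_inner f (gabor_system g' a b i)" if "f \<in> L2" for f i
  proof -
    obtain k m where i: "i = (k, m)" by (cases i)
    have [measurable]: "f \<in> borel_measurable borel" using that by (simp add: L2_def)
    have [measurable]: "(\<lambda>x. exp (2 * of_real pi * \<i> * of_real (b * of_int m * x))) \<in> borel_measurable borel"
      by (intro borel_measurable_continuous_onI continuous_intros)
    have "AE x in lborel. g (- (a * of_int k) + 1 * x) = g' (- (a * of_int k) + 1 * x)"
      by (rule AE_borel_affine[OF _ _ ae]) auto
    then have "AE x in lborel. g (x - a * of_int k) = g' (x - a * of_int k)" by simp
    moreover have "(\<lambda>x. f x * cnj (gabor_system p a b (k, m) x)) \<in> borel_measurable borel"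
      if [measurable]: "p \<in> borel_measurable borel" for p
    proof -
      have "gabor_system p a b (k, m) \<in> borel_measurable borel"
        unfolding gabor_system_def prod.case by measurable
      from borel_measurable_continuous_on[OF continuous_on_cnj[OF continuous_on_id] this]
      have [measurable]: "(\<lambda>x. cnj (gabor_system p a b (k, m) x)) \<in> borel_measurable borel" .
      show ?thesis by measurable
    qed
    ultimately show ?thesis
      unfolding L2_inner_def i by (intro integral_cong_AE) (auto simp: gabor_system_def)
  qed
  show ?thesis unfolding L2_frame_def by (simp add: inner cong: ball_cong)
qed

section \<open>Hermite functions\<close>

text \<open>
  The polynomial factor of the \<open>n\<close>th derivative of \<open>exp (- 2 \<pi> t\<^sup>2)\<close>, given by its three-term recursion.
\<close>

fun hermite_poly :: "nat \<Rightarrow> real \<Rightarrow> real" where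
  "hermite_poly 0 x = 1"
| "hermite_poly (Suc 0) x = - 4 * pi * x"
| "hermite_poly (Suc (Suc n)) x = - 4 * pi * x * hermite_poly (Suc n) x - 4 * pi * real (Suc n) * hermite_poly n x"

lemma hermite_poly_step:
  "hermite_poly (Suc n) x = - 4 * pi * x * hermite_poly n x - 4 * pi * real n * hermite_poly (n - 1) x"
  by (cases n) simp_all

lemma has_real_derivative_hermite_poly:
  "(hermite_poly n has_real_derivative - 4 * pi * real n * hermite_poly (n - 1) x) (at x)"
proof (induction n x rule: hermite_poly.induct)
  case (1 x)
  then show ?case by (simp add: hermite_poly.simps(1)[abs_def])
next
  case (2 x)
  have eq: "hermite_poly (Suc 0) = (\<lambda>x. - 4 * pi * x)" by (rule ext) simp
  show ?case unfolding eq by (auto intro!: derivative_eq_intros)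
next
  case (3 n x)
  have eq: "hermite_poly (Suc (Suc n)) = (\<lambda>x. - 4 * pi * x * hermite_poly (Suc n) x - 4 * pi * real (Suc n) * hermite_poly n x)"
    by (rule ext) simp
  show ?case unfolding eq
    by (rule derivative_eq_intros 3 refl)+ (simp add: hermite_poly_step[of n] algebra_simps)
qed

lemma deriv_iter_gaussian:
  "(deriv ^^ n) (\<lambda>t. exp (- 2 * pi * t\<^sup>2)) = (\<lambda>t::real. hermite_poly n t * exp (- 2 * pi * t\<^sup>2))"
proof (induction n)
  case (Suc n)
  have "((\<lambda>t. hermite_poly n t * exp (- 2 * pi * t\<^sup>2)) has_real_derivative hermite_poly (Suc n) t * exp (- 2 * pi * t\<^sup>2)) (at t)" for t
    by (rule derivative_eq_intros has_real_derivative_hermite_poly refl)+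
      (simp add: hermite_poly_step[of n] algebra_simps)
  then show ?case unfolding funpow.simps o_def Suc by (intro ext DERIV_imp_deriv)
qed simp

definition hermite_gauss :: "nat \<Rightarrow> real \<Rightarrow> real" where
  "hermite_gauss n x = hermite_poly n x * exp (- pi * x\<^sup>2)"

lemma hermite_fun_eq: "hermite_fun n x = hermite_const n powr (- 1 / 2) * hermite_gauss n x"
proof -
  have "exp (pi * x\<^sup>2) * exp (- 2 * pi * x\<^sup>2) = exp (- pi * x\<^sup>2)"
    by (simp add: exp_add[symmetric])
  then have "exp (pi * x\<^sup>2) * (hermite_poly n x * exp (- 2 * pi * x\<^sup>2)) = hermite_poly n x * exp (- pi * x\<^sup>2)"
    by (simp only: mult.left_commute)
  then show ?thesis unfolding hermite_fun_def deriv_iter_gaussian hermite_gauss_def by (simp only: mult.assoc)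
qed

lemma hermite_gauss_step:
  "hermite_gauss (Suc n) x = - 4 * pi * x * hermite_gauss n x - 4 * pi * real n * hermite_gauss (n - 1) x"
  by (simp add: hermite_gauss_def hermite_poly_step[of n] algebra_simps)

text \<open>
  The product \<open>x h\<^sub>n\<close> is eliminated from the derivative in favour of the neighbours \<open>h\<^sub>n\<^sub>+\<^sub>1\<close> and \<open>h\<^sub>n\<^sub>-\<^sub>1\<close>.
  In this form, integration by parts gives a recursion for the Fourier transforms without any
  differentiation under the integral sign.
\<close>

lemma has_real_derivative_hermite_gauss:
  "(hermite_gauss n has_real_derivative (hermite_gauss (Suc n) x - 4 * pi * real n * hermite_gauss (n - 1) x) / 2) (at x)"
  unfolding hermite_gauss_def[abs_def]
  by (rule derivative_eq_intros has_real_derivative_hermite_poly refl)+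
    (simp add: hermite_poly_step[of n] field_simps)

lemma continuous_hermite_gauss [continuous_intros]: "continuous_on A (hermite_gauss n)"
  using has_real_derivative_hermite_gauss by (intro DERIV_continuous_on) (rule DERIV_subset, auto)

text \<open>
  The induction treats all powers \<open>k\<close> at once, because the recursion for \<open>h\<^sub>n\<close> raises the power by one.
\<close>

lemma hermite_gauss_power_bounded: "\<exists>C. \<forall>x. \<bar>x ^ k * hermite_gauss n x\<bar> \<le> C"
proof (induction n arbitrary: k rule: less_induct)
  case (less n)
  show ?case
  proof (cases n)
    case 0
    have "\<bar>x ^ k * hermite_gauss 0 x\<bar> \<le> fact k * exp 1" for x :: real
    proof -
      have "\<bar>x\<bar> ^ k \<le> fact k * exp \<bar>x\<bar>"
      proof -
        have "(\<Sum>i\<in>{k}. \<bar>x\<bar> ^ i /\<^sub>R fact i) \<le> exp \<bar>x\<bar>"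
          unfolding sums_unique[OF exp_converges] by (rule sum_le_suminf[OF sums_summable[OF exp_converges]]) auto
        then show ?thesis by (simp add: field_simps)
      qed
      moreover have "\<bar>x\<bar> - pi * x\<^sup>2 \<le> 1"
      proof -
        have "1 * x\<^sup>2 \<le> pi * x\<^sup>2" using pi_gt3 by (intro mult_right_mono) auto
        moreover have "0 \<le> (\<bar>x\<bar> - 1/2)\<^sup>2" by simp
        then have "\<bar>x\<bar> \<le> 1 + x\<^sup>2" by (simp add: power2_eq_square algebra_simps)
        ultimately show ?thesis by linarith
      qed
      then have "exp \<bar>x\<bar> * exp (- pi * x\<^sup>2) \<le> exp 1"
        unfolding exp_add[symmetric] by simp
      ultimately have "\<bar>x\<bar> ^ k * exp (- pi * x\<^sup>2) \<le> fact k * exp \<bar>x\<bar> * exp (- pi * x\<^sup>2)"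
        by (intro mult_right_mono) auto
      also have "\<dots> \<le> fact k * exp 1"
        unfolding mult.assoc using \<open>exp \<bar>x\<bar> * exp (- pi * x\<^sup>2) \<le> exp 1\<close> by (intro mult_left_mono) auto
      finally show ?thesis by (simp add: hermite_gauss_def abs_mult power_abs)
    qed
    then show ?thesis using 0 by blast
  next
    case (Suc m)
    obtain C1 where C1: "\<And>x. \<bar>x ^ Suc k * hermite_gauss m x\<bar> \<le> C1" using less[of m "Suc k"] Suc by blast
    have "m - 1 < n" using Suc by simp
    then obtain C2 where C2: "\<And>x. \<bar>x ^ k * hermite_gauss (m - 1) x\<bar> \<le> C2" using less[of "m - 1" k] by blast
    have "\<bar>x ^ k * hermite_gauss n x\<bar> \<le> 4 * pi * C1 + 4 * pi * real m * C2" for x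
    proof -
      have "x ^ k * hermite_gauss n x = - (4 * pi * (x ^ Suc k * hermite_gauss m x)) - 4 * pi * real m * (x ^ k * hermite_gauss (m - 1) x)"
        unfolding Suc hermite_gauss_step by (simp add: algebra_simps)
      also have "\<bar>\<dots>\<bar> \<le> \<bar>4 * pi * (x ^ Suc k * hermite_gauss m x)\<bar> + \<bar>4 * pi * real m * (x ^ k * hermite_gauss (m - 1) x)\<bar>"
        by linarith
      also have "\<dots> \<le> 4 * pi * C1 + 4 * pi * real m * C2"
        unfolding abs_mult[of "4 * pi"] abs_mult[of "4 * pi * real m"]
        by (intro add_mono mult_mono C1 C2) auto
      finally show ?thesis .
    qed
    then show ?thesis by blast
  qed
qed

lemma hermite_gauss_decay: "\<exists>C. \<forall>x. \<bar>hermite_gauss n x\<bar> \<le> C / (1 + x\<^sup>2)"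
proof -
  obtain C0 C2 where C: "\<And>x. \<bar>x ^ 0 * hermite_gauss n x\<bar> \<le> C0" "\<And>x. \<bar>x ^ 2 * hermite_gauss n x\<bar> \<le> C2"
    using hermite_gauss_power_bounded by metis
  have "\<bar>hermite_gauss n x\<bar> * (1 + x\<^sup>2) \<le> C0 + C2" for x
    using add_mono[OF C(1)[of x] C(2)[of x]] by (simp add: abs_mult algebra_simps)
  then have "\<bar>hermite_gauss n x\<bar> \<le> (C0 + C2) / (1 + x\<^sup>2)" for x
    by (simp add: field_simps add_pos_nonneg)
  then show ?thesis by blast
qed

text \<open>
  The characteristic function of the standard normal distribution, rescaled by \<open>\<surd>(2 \<pi>)\<close>.
\<close>

lemma fourier_gaussian:
  "(LINT x|lborel. of_real (exp (- pi * x\<^sup>2)) * cis (- (2 * pi * \<gamma> * x))) = of_real (exp (- pi * \<gamma>\<^sup>2))"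
proof -
  define c where "c = sqrt (2 * pi)"
  have c: "0 < c" "c * c = 2 * pi" by (simp_all add: c_def)
  have "complex_of_real (exp (- pi * \<gamma>\<^sup>2)) = char std_normal_distribution (- (c * \<gamma>))"
  proof -
    have "(c * \<gamma>)\<^sup>2 / 2 = pi * \<gamma>\<^sup>2" using c(2) by (simp add: power2_eq_square algebra_simps)
    then show ?thesis by (simp add: char_std_normal_distribution)
  qed
  also have "\<dots> = (LINT y|lborel. std_normal_density y *\<^sub>R iexp (- (c * \<gamma>) * y))"
    unfolding char_def by (rule integral_density) auto
  also have "\<dots> = c *\<^sub>R (LINT x|lborel. std_normal_density (0 + c * x) *\<^sub>R iexp (- (c * \<gamma>) * (0 + c * x)))"
    using c by (subst lborel_integral_real_affine[of c _ 0]) auto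
  also have "\<dots> = (LINT x|lborel. c *\<^sub>R (std_normal_density (0 + c * x) *\<^sub>R iexp (- (c * \<gamma>) * (0 + c * x))))"
    by (rule integral_scaleR_right[symmetric]) 
  also have "\<dots> = (LINT x|lborel. of_real (exp (- pi * x\<^sup>2)) * cis (- (2 * pi * \<gamma> * x)))"
  proof (rule Bochner_Integration.integral_cong[OF refl])
    fix x :: real
    have "(c * x)\<^sup>2 / 2 = pi * x\<^sup>2" using c(2) by (simp add: power2_eq_square algebra_simps)
    then have d: "c * std_normal_density (0 + c * x) = exp (- pi * x\<^sup>2)"
      using c by (simp add: std_normal_density_def c_def[symmetric])
    have "- (c * \<gamma>) * (0 + c * x) = - (2 * pi * \<gamma> * x)"
      unfolding c(2)[symmetric] by (simp add: mult_ac)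
    then have "iexp (- (c * \<gamma>) * (0 + c * x)) = cis (- (2 * pi * \<gamma> * x))"
      by (simp only: cis_conv_exp)
    then show "c *\<^sub>R (std_normal_density (0 + c * x) *\<^sub>R iexp (- (c * \<gamma>) * (0 + c * x))) =
        of_real (exp (- pi * x\<^sup>2)) * cis (- (2 * pi * \<gamma> * x))"
      by (simp only: scaleR_conv_of_real mult.assoc[symmetric] of_real_mult[symmetric] d)
  qed
  finally show ?thesis ..
qed

lemma integrable_hermite_gauss_cis:
  "integrable lborel (\<lambda>x. of_real (hermite_gauss n x) * cis (r * x))"
proof -
  obtain C where "\<And>x. \<bar>hermite_gauss n x\<bar> \<le> C / (1 + x\<^sup>2)" using hermite_gauss_decay by blast
  then have "tile_dominated (\<lambda>x. of_real (hermite_gauss n x) * cis (r * x)) (\<lambda>k. 3 * C * (1 / (1 + (of_int k)\<^sup>2)))"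
    by (intro quadratic_decay_tile_dominated) (simp add: norm_mult)
  then show ?thesis
    by (rule tile_dominated_integrable[rotated]) (intro borel_measurable_continuous_onI continuous_intros)
qed

lemma integral_derivative_hermite_gauss_cis:
  "(LINT x|lborel. of_real ((hermite_gauss (Suc n) x - 4 * pi * real n * hermite_gauss (n - 1) x) / 2) * cis (r * x)) =
    - \<i> * of_real r * (LINT x|lborel. of_real (hermite_gauss n x) * cis (r * x))"
proof -
  define h' where "h' x = (hermite_gauss (Suc n) x - 4 * pi * real n * hermite_gauss (n - 1) x) / 2" for x
  define F where "F x = of_real (hermite_gauss n x) * cis (r * x)" for x
  define f where "f x = of_real (h' x) * cis (r * x) + \<i> * of_real r * F x" for x
  have h'_eq: "of_real (h' x) * cis (r * x) =
      1/2 * (of_real (hermite_gauss (Suc n) x) * cis (r * x)) - 2 * of_real (pi * real n) * (of_real (hermite_gauss (n - 1) x) * cis (r * x))" for x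
    by (simp add: h'_def field_simps)
  have int_h': "integrable lborel (\<lambda>x. of_real (h' x) * cis (r * x))"
    unfolding h'_eq by (intro Bochner_Integration.integrable_diff integrable_mult_right integrable_hermite_gauss_cis)
  have int_F: "integrable lborel F" unfolding F_def by (rule integrable_hermite_gauss_cis)
  have int_f: "integrable lborel f"
    unfolding f_def by (intro Bochner_Integration.integrable_add integrable_mult_right int_h' int_F)
  obtain C where C: "\<And>x. \<bar>hermite_gauss n x\<bar> \<le> C / (1 + x\<^sup>2)" using hermite_gauss_decay by blast
  have F_bound: "norm (F x) \<le> C / (1 + x\<^sup>2)" for x
    using C[of x] by (simp add: F_def norm_mult)
  have "(LBINT x=-\<infinity>..\<infinity>. f x) = 0 - 0"
  proof (rule interval_integral_FTC_integrable)
    fix x :: real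
    have "((\<lambda>x. exp (\<i> * of_real r * of_real x)) has_vector_derivative exp (\<i> * of_real r * of_real x) * (\<i> * of_real r)) (at x)"
      by (auto intro!: derivative_eq_intros has_vector_derivative_real_field)
    then have cis: "((\<lambda>x. cis (r * x)) has_vector_derivative cis (r * x) * (\<i> * of_real r)) (at x)"
      by (simp add: cis_conv_exp mult_ac)
    have "((\<lambda>x. complex_of_real (hermite_gauss n x)) has_vector_derivative of_real (h' x)) (at x)"
      using has_real_derivative_hermite_gauss[of n x] unfolding h'_def
      by (intro has_vector_derivative_of_real) (simp add: has_real_derivative_iff_has_vector_derivative)
    from has_vector_derivative_mult[OF this cis]
    show "(F has_vector_derivative f x) (at x)"
      by (simp add: F_def[abs_def] f_def algebra_simps)
    have "continuous_on UNIV f"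
      unfolding f_def F_def h'_def by (intro continuous_intros) auto
    then show "isCont f x" by (simp add: continuous_on_eq_continuous_at)
  next
    have "((\<lambda>x::real. C / (1 + x\<^sup>2)) \<longlongrightarrow> 0) at_top" "((\<lambda>x::real. C / (1 + x\<^sup>2)) \<longlongrightarrow> 0) at_bot"
      by real_asymp+
    from this[THEN Lim_null_comparison[OF always_eventually[OF allI[OF F_bound]]]]
    show "((F \<circ> real_of_ereal) \<longlongrightarrow> 0) (at_right (-\<infinity>))" "((F \<circ> real_of_ereal) \<longlongrightarrow> 0) (at_left \<infinity>)"
      by (simp_all add: ereal_tendsto_simps)
  qed (use int_f in \<open>auto simp: set_integrable_def einterval_def\<close>)
  then have "(LINT x|lborel. f x) = 0"
    by (simp add: interval_lebesgue_integral_def einterval_def set_lebesgue_integral_def)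
  then have "(LINT x|lborel. of_real (h' x) * cis (r * x)) + \<i> * of_real r * (LINT x|lborel. F x) = 0"
    unfolding f_def using int_h' int_F by simp
  then show ?thesis unfolding h'_def F_def by (simp add: add_eq_0_iff2)
qed

text \<open>
  With \<open>T\<^sub>n\<close> the transform of \<open>h\<^sub>n\<close>, integration by parts gives
  \<open>T\<^sub>n\<^sub>+\<^sub>1 = 4 \<pi> \<i> \<gamma> T\<^sub>n + 4 \<pi> n T\<^sub>n\<^sub>-\<^sub>1\<close>. This is the recursion satisfied by \<open>(-\<i>)\<^sup>n h\<^sub>n(\<gamma>)\<close>.
\<close>

lemma fourier_hermite_gauss:
  "fourier (\<lambda>x. of_real (hermite_gauss n x)) \<gamma> = (- \<i>) ^ n * of_real (hermite_gauss n \<gamma>)"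
proof -
  define T where "T n = fourier (\<lambda>x. of_real (hermite_gauss n x)) \<gamma>" for n
  have T_eq: "T n = (LINT x|lborel. of_real (hermite_gauss n x) * cis (- (2 * pi * \<gamma>) * x))" for n
    by (simp add: T_def fourier_eq_cis)
  have step: "T (Suc n) = 4 * of_real (pi * \<gamma>) * \<i> * T n + 4 * of_real (pi * real n) * T (n - 1)" for n
  proof -
    have eq: "of_real ((hermite_gauss (Suc n) x - 4 * pi * real n * hermite_gauss (n - 1) x) / 2) * cis (- (2 * pi * \<gamma>) * x) =
      1/2 * (of_real (hermite_gauss (Suc n) x) * cis (- (2 * pi * \<gamma>) * x)) - 2 * of_real (pi * real n) * (of_real (hermite_gauss (n - 1) x) * cis (- (2 * pi * \<gamma>) * x))" for x
      by (simp add: field_simps)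
    have "has_bochner_integral lborel (\<lambda>x. 1/2 * (of_real (hermite_gauss (Suc n) x) * cis (- (2 * pi * \<gamma>) * x)) -
        2 * of_real (pi * real n) * (of_real (hermite_gauss (n - 1) x) * cis (- (2 * pi * \<gamma>) * x)))
        (1/2 * T (Suc n) - 2 * of_real (pi * real n) * T (n - 1))"
      unfolding T_eq by (intro has_bochner_integral_diff has_bochner_integral_mult_right has_bochner_integral_integrable integrable_hermite_gauss_cis)
    from has_bochner_integral_integral_eq[OF this]
    have "1/2 * T (Suc n) - 2 * of_real (pi * real n) * T (n - 1) = - \<i> * of_real (- (2 * pi * \<gamma>)) * T n"
      using integral_derivative_hermite_gauss_cis[of n "- (2 * pi * \<gamma>)"] unfolding eq T_eq[symmetric] by (simp only:)
    then show ?thesis by (simp add: field_simps)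
  qed
  have "T n = (- \<i>) ^ n * of_real (hermite_gauss n \<gamma>)"
  proof (induction n rule: less_induct)
    case (less n)
    have base: "T 0 = of_real (hermite_gauss 0 \<gamma>)"
      using fourier_gaussian[of \<gamma>] by (simp add: T_eq hermite_gauss_def)
    consider "n = 0" | "n = Suc 0" | m where "n = Suc (Suc m)" by (metis not0_implies_Suc)
    then show ?case
    proof cases
      case 1 then show ?thesis using base by simp
    next
      case 2 then show ?thesis using step[of 0] base hermite_gauss_step[of 0 \<gamma>] by simp
    next
      case (3 m)
      have "T (Suc m) = (- \<i>) ^ Suc m * of_real (hermite_gauss (Suc m) \<gamma>)" "T m = (- \<i>) ^ m * of_real (hermite_gauss m \<gamma>)"
        using less 3 by auto
      then show ?thesis
        unfolding 3 step[of "Suc m"] hermite_gauss_step[of "Suc m"] by (simp add: algebra_simps)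
    qed
  qed
  then show ?thesis by (simp add: T_def)
qed

lemma hermite_fun_eigenfunction:
  "fourier (\<lambda>x. of_real (hermite_fun n x)) \<gamma> = (- \<i>) ^ n * of_real (hermite_fun n \<gamma>)"
proof -
  have "fourier (\<lambda>x. of_real (hermite_fun n x)) \<gamma> =
      of_real (hermite_const n powr (- 1 / 2)) * fourier (\<lambda>x. of_real (hermite_gauss n x)) \<gamma>"
    unfolding fourier_eq_cis hermite_fun_eq of_real_mult mult.assoc by (rule integral_mult_right_zero)
  then show ?thesis by (simp add: fourier_hermite_gauss hermite_fun_eq)
qed

lemma hermite_fun_tile_dominated: "\<exists>u. tile_dominated (\<lambda>x. of_real (hermite_fun n x)) u"
proof -
  let ?c = "\<bar>hermite_const n powr (- 1 / 2)\<bar>"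
  obtain C where C: "\<And>x. \<bar>hermite_gauss n x\<bar> \<le> C / (1 + x\<^sup>2)" using hermite_gauss_decay by blast
  have "cmod (of_real (hermite_fun n x)) \<le> ?c * C / (1 + x\<^sup>2)" for x
    using mult_left_mono[OF C[of x], of ?c] by (simp add: hermite_fun_eq norm_mult)
  then show ?thesis by (blast intro: quadratic_decay_tile_dominated)
qed

lemma continuous_hermite_fun: "continuous_on UNIV (\<lambda>x. complex_of_real (hermite_fun n x))"
  unfolding hermite_fun_eq by (intro continuous_intros)

section \<open>Failure of the frame property\<close>

theorem theorem7:
  fixes a b :: real
  assumes "(a, b) \<in> {(1 / sqrt 2, 1 / sqrt 2), (1 / sqrt 3, 1 / sqrt 3),
                     (2 / sqrt 3, 1 / sqrt 3), (1 / sqrt 3, 2 / sqrt 3)}"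
  shows "(\<forall>g \<in> fourier_eigenspace 2 \<inter> wiener_space. \<not> L2_frame (gabor_system g a b)) \<and>
         (\<forall>n m :: nat. n = 4 * m + 2 \<longrightarrow>
            \<not> L2_frame (gabor_system (\<lambda>x. complex_of_real (hermite_fun n x)) a b))"
proof (intro conjI ballI allI impI)
  fix g assume "g \<in> fourier_eigenspace 2 \<inter> wiener_space"
  then obtain g' u where g': "continuous_on UNIV g'" "tile_dominated g' u" "\<And>\<gamma>. fourier g' \<gamma> = - g' \<gamma>"
    and ae: "AE x in lborel. g x = g' x" "g \<in> borel_measurable borel" "g' \<in> borel_measurable borel"
    by (rule continuous_representative) blast
  show "\<not> L2_frame (gabor_system g a b)"
    unfolding L2_frame_gabor_AE_cong[OF ae] by (rule gabor_not_frame_continuous[OF g' assms])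
next
  fix n m :: nat assume n: "n = 4 * m + 2"
  obtain u where u: "tile_dominated (\<lambda>x. complex_of_real (hermite_fun n x)) u"
    using hermite_fun_tile_dominated by blast
  have "(- \<i>) ^ n = - 1"
    unfolding n power_add power_mult by simp
  then have "fourier (\<lambda>x. complex_of_real (hermite_fun n x)) \<gamma> = - complex_of_real (hermite_fun n \<gamma>)" for \<gamma>
    by (simp add: hermite_fun_eigenfunction)
  then show "\<not> L2_frame (gabor_system (\<lambda>x. complex_of_real (hermite_fun n x)) a b)"
    by (rule gabor_not_frame_continuous[OF continuous_hermite_fun u _ assms])
qed

end
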